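(* Let $\mathfrak g$ be a finite dimensional Lie superalgebra over $\mathbb C$, and consider in $\mathfrak g\oplus\mathfrak g$ the subalgebras $\mathfrak g_1=\{(x,(-1)^{p(x)}x)\mid x\in\mathfrak g\}$ and $\mathfrak g_2=\{(x,x)\mid x\in\mathfrak g\}$. The algebra of functionals on $U(\mathfrak g\oplus\mathfrak g)$ biinvariant with respect to $\mathfrak g_1$ and $\mathfrak g_2$ is isomorphic to the algebra of functionals on $U(\mathfrak g)$ invariant with respect to the action $$x*u=xu-(-1)^{p(x)(p(u)+1)}ux\qquad(x\in\mathfrak g,\ u\in U(\mathfrak g)).$$
   Context: $p$ denotes parity; formulas are for homogeneous elements and extended by linearity (so $\mathfrak g_1$ is the graph of the automorphism $x\mapsto(-1)^{p(x)}x$). A functional $l$ on $U(\mathfrak g\oplus\mathfrak g)$ is biinvariant if $l(x_1u)=l(ux_2)=0$ for all $x_1\in\mathfrak g_1$, $x_2\in\mathfrak g_2$, $u\in U(\mathfrak g\oplus\mathfrak g)$. A functional $l$ on $U(\mathfrak g)$ is invariant with respect to $*$ if $l(x*u)=0$ for all $x\in\mathfrak g$, $u\in U(\mathfrak g)$. For a Lie superalgebra $\mathfrak a$, the product on $U(\mathfrak a)^*$ is dual to the coproduct $c:U(\mathfrak a)\to U(\mathfrak a)\otimes U(\mathfrak a)$, $c(x)=x\otimes1+1\otimes x$ for $x\in\mathfrak a$: $(l_1l_2)(u)=(l_1\otimes l_2)(c(u))$, where $(l_1\otimes l_2)(u_1\otimes u_2)=(-1)^{p(u_1)p(l_2)}l_1(u_1)l_2(u_2)$.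 *)

theory Defs
  imports Complex_Main "HOL-Library.Poly_Mapping" "HOL-Library.Z2" "HOL-Library.Product_Plus"
begin

section \<open>Complex vector spaces\<close>

class cvector_space = ab_group_add +
  fixes scaleC :: "complex \<Rightarrow> 'a \<Rightarrow> 'a" (infixr "*\<^sub>C" 75)
  assumes scaleC_right_distrib: "c *\<^sub>C (x + y) = c *\<^sub>C x + c *\<^sub>C y"
    and scaleC_left_distrib: "(c + d) *\<^sub>C x = c *\<^sub>C x + d *\<^sub>C x"
    and scaleC_scaleC: "c *\<^sub>C (d *\<^sub>C x) = (c * d) *\<^sub>C x"
    and scaleC_one: "1 *\<^sub>C x = x"

global_interpretation cv: vector_space "scaleC :: complex \<Rightarrow> 'a \<Rightarrow> 'a::cvector_space"
  by standard (simp_all add: scaleC_right_distrib scaleC_left_distrib scaleC_scaleC scaleC_one)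

abbreviation clinear :: "('a::cvector_space \<Rightarrow> 'b::cvector_space) \<Rightarrow> bool" where
  "clinear f \<equiv> Vector_Spaces.linear scaleC scaleC f"

lemma clinearI:
  fixes f :: "'a::cvector_space \<Rightarrow> 'b::cvector_space"
  assumes "\<And>x y. f (x + y) = f x + f y" "\<And>c x. f (c *\<^sub>C x) = c *\<^sub>C f x"
  shows "clinear f"
  by unfold_locales (auto simp: assms)

lemma clinear_simps:
  assumes "clinear f"
  shows "f (x + y) = f x + f y" "f (c *\<^sub>C x) = c *\<^sub>C f x" "f 0 = 0"
    "f (x - y) = f x - f y" "f (- x) = - f x" "f (sum g A) = (\<Sum>a\<in>A. f (g a))"
proof -
  interpret Vector_Spaces.linear scaleC scaleC f by fact
  show "f (x + y) = f x + f y" "f (c *\<^sub>C x) = c *\<^sub>C f x" "f 0 = 0"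
    "f (x - y) = f x - f y" "f (- x) = - f x" "f (sum g A) = (\<Sum>a\<in>A. f (g a))"
    by (rule add scale zero diff neg sum)+
qed

lemma clinear_compose: "clinear f \<Longrightarrow> clinear g \<Longrightarrow> clinear (\<lambda>x. g (f x))"
  by (rule clinearI) (simp_all add: clinear_simps)

lemma clinear_vanish_span:
  assumes "clinear f" "\<And>x. x \<in> S \<Longrightarrow> f x = 0" "x \<in> cv.span S"
  shows "f x = 0"
  using assms(3)
  by (induction rule: cv.span_induct)
     (auto simp: cv.subspace_def clinear_simps[OF assms(1)] assms(2))

instantiation complex :: cvector_space
begin
definition scaleC_complex :: "complex \<Rightarrow> complex \<Rightarrow> complex" where
  "scaleC_complex = (*)"
instance by standard (simp_all add: scaleC_complex_def algebra_simps)
end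

instantiation prod :: (cvector_space, cvector_space) cvector_space
begin
definition scaleC_prod :: "complex \<Rightarrow> 'a \<times> 'b \<Rightarrow> 'a \<times> 'b" where
  "scaleC_prod c z = (c *\<^sub>C fst z, c *\<^sub>C snd z)"
instance
  by standard (simp_all add: scaleC_prod_def scaleC_right_distrib scaleC_left_distrib
      scaleC_scaleC scaleC_one)
end

instantiation poly_mapping :: (type, cvector_space) cvector_space
begin
definition scaleC_poly_mapping :: "complex \<Rightarrow> ('a \<Rightarrow>\<^sub>0 'b) \<Rightarrow> ('a \<Rightarrow>\<^sub>0 'b)" where
  "scaleC_poly_mapping c = Poly_Mapping.map (scaleC c)"

lemma lookup_scaleC: "Poly_Mapping.lookup (c *\<^sub>C p) k = c *\<^sub>C Poly_Mapping.lookup p k"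
  for p :: "'a \<Rightarrow>\<^sub>0 'b"
  by (simp add: scaleC_poly_mapping_def Poly_Mapping.map.rep_eq when_def)

instance
  by standard (rule poly_mapping_eqI,
      simp add: lookup_scaleC lookup_add scaleC_right_distrib scaleC_left_distrib
        scaleC_scaleC scaleC_one)+
end

subsection \<open>Linear extension from a free vector space\<close>

abbreviation basis_vec :: "'k \<Rightarrow> ('k \<Rightarrow>\<^sub>0 complex)" where
  "basis_vec k \<equiv> Poly_Mapping.single k 1"

definition free_extend :: "('k \<Rightarrow> 'b::cvector_space) \<Rightarrow> ('k \<Rightarrow>\<^sub>0 complex) \<Rightarrow> 'b" where
  "free_extend f p = (\<Sum>k\<in>Poly_Mapping.keys p. Poly_Mapping.lookup p k *\<^sub>C f k)"

lemma free_extend_superset: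
  assumes "finite A" "Poly_Mapping.keys p \<subseteq> A"
  shows "free_extend f p = (\<Sum>k\<in>A. Poly_Mapping.lookup p k *\<^sub>C f k)"
  unfolding free_extend_def using assms
  by (intro sum.mono_neutral_left) (auto simp: in_keys_iff)

lemma free_extend_linear: "clinear (free_extend f)"
proof (rule clinearI)
  fix p q :: "'a \<Rightarrow>\<^sub>0 complex"
  let ?A = "Poly_Mapping.keys p \<union> Poly_Mapping.keys q"
  have "Poly_Mapping.keys (p + q) \<subseteq> ?A" by (rule Poly_Mapping.keys_add)
  then show "free_extend f (p + q) = free_extend f p + free_extend f q"
    by (simp add: free_extend_superset[of ?A] lookup_add scaleC_left_distrib sum.distrib)
next
  fix c and p :: "'a \<Rightarrow>\<^sub>0 complex"
  have "Poly_Mapping.keys (c *\<^sub>C p) \<subseteq> Poly_Mapping.keys p"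
    by (auto simp: in_keys_iff lookup_scaleC scaleC_complex_def)
  then show "free_extend f (c *\<^sub>C p) = c *\<^sub>C free_extend f p"
    by (simp add: free_extend_superset[of "Poly_Mapping.keys p"] lookup_scaleC
        scaleC_complex_def cv.scale_sum_right)
qed

lemma free_extend_single: "free_extend f (Poly_Mapping.single k c) = c *\<^sub>C f k"
  by (cases "c = 0") (simp_all add: free_extend_def)

lemma free_induct [case_names zero single add]:
  fixes p :: "'k \<Rightarrow>\<^sub>0 complex"
  assumes "P 0" "\<And>k c. P (Poly_Mapping.single k c)" "\<And>p q. P p \<Longrightarrow> P q \<Longrightarrow> P (p + q)"
  shows "P p"
proof -
  have eq: "p = (\<Sum>k\<in>Poly_Mapping.keys p. Poly_Mapping.single k (Poly_Mapping.lookup p k))"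
  proof (rule poly_mapping_eqI)
    fix j
    show "Poly_Mapping.lookup p j = Poly_Mapping.lookup
       (\<Sum>k\<in>Poly_Mapping.keys p. Poly_Mapping.single k (Poly_Mapping.lookup p k)) j"
      by (simp add: lookup_sum lookup_single when_def in_keys_iff)
  qed
  have "finite A \<Longrightarrow> P (\<Sum>k\<in>A. Poly_Mapping.single k (Poly_Mapping.lookup p k))" for A
    by (induction A rule: finite_induct) (auto intro: assms)
  then show ?thesis using eq by (metis finite_keys)
qed

lemma scaleC_single: "c *\<^sub>C Poly_Mapping.single k d = Poly_Mapping.single k (c * d)"
  for d :: complex
  by (rule poly_mapping_eqI) (simp add: lookup_scaleC lookup_single when_def scaleC_complex_def)


section \<open>\<open>\<int>/2\<close>-graded spaces\<close>

text \<open>Parities are elements of \<open>\<int>/2\<close>, rendered by the field \<^typ>\<open>bit\<close>.\<close>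

declare add_bit_eq_xor [simp del] mult_bit_eq_and [simp del]

definition sign :: "bit \<Rightarrow> complex" where
  "sign i = (if i = 0 then 1 else - 1)"

lemma sign_simps [simp]: "sign 0 = 1" "sign 1 = - 1"
  by (simp_all add: sign_def)

lemma sign_add: "sign (i + j) = sign i * sign j"
  by (cases i; cases j) simp_all

class super_space = cvector_space +
  fixes grade :: "bit \<Rightarrow> 'a set"
  assumes zero_grade: "0 \<in> grade i"
    and add_grade: "x \<in> grade i \<Longrightarrow> y \<in> grade i \<Longrightarrow> x + y \<in> grade i"
    and scaleC_grade: "x \<in> grade i \<Longrightarrow> c *\<^sub>C x \<in> grade i"
    and grade_span: "\<exists>y z. y \<in> grade 0 \<and> z \<in> grade 1 \<and> x = y + z"
    and grade_disjoint: "grade 0 \<inter> grade 1 = {0}"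

lemma subspace_grade: "cv.subspace (grade i)"
  by (simp add: cv.subspace_def zero_grade add_grade scaleC_grade)

text \<open>\<open>part i x\<close> is the homogeneous component of parity \<open>i\<close> of \<open>x\<close>.\<close>

definition part :: "bit \<Rightarrow> 'a::super_space \<Rightarrow> 'a" where
  "part i x = (THE y. y \<in> grade i \<and> x - y \<in> grade (i + 1))"

definition parity_aut :: "'a::super_space \<Rightarrow> 'a" where
  "parity_aut x = (\<Sum>i\<in>{0,1}. sign i *\<^sub>C part i x)"

lemmas grade_closed = cv.subspace_add[OF subspace_grade] cv.subspace_diff[OF subspace_grade]
  cv.subspace_scale[OF subspace_grade] cv.subspace_0[OF subspace_grade]
  cv.subspace_neg[OF subspace_grade]

lemma grade_unique: "x \<in> grade i \<Longrightarrow> x \<in> grade (i + 1) \<Longrightarrow> x = 0"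
  using grade_disjoint by (cases i) auto

lemma part_eqI:
  assumes "y \<in> grade i" "x - y \<in> grade (i + 1)"
  shows "part i x = y"
  unfolding part_def
proof (rule the_equality)
  fix z assume z: "z \<in> grade i \<and> x - z \<in> grade (i + 1)"
  have "z - y \<in> grade i" using z assms by (auto intro: grade_closed)
  moreover have "(x - y) - (x - z) \<in> grade (i + 1)"
    using z assms by (blast intro: grade_closed)
  ultimately show "z = y" using grade_unique[of "z - y" i] by simp
qed (use assms in auto)

lemma part_props: "part i x \<in> grade i" "x - part i x \<in> grade (i + 1)"
proof -
  obtain y z where yz: "y \<in> grade 0" "z \<in> grade 1" "x = y + z" using grade_span by blast
  have "part i x = (if i = 0 then y else z)"
    by (rule part_eqI) (use yz in \<open>cases i; auto\<close>)+
  then show "part i x \<in> grade i" "x - part i x \<in> grade (i + 1)" using yz by (cases i; auto)+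
qed

lemma part_sum: "part 0 x + part 1 x = x"
proof -
  have "part 1 x = x - part 0 x"
    by (rule part_eqI) (use part_props[where i = 0 and x = x] in auto)
  then show ?thesis by simp
qed

lemma part_homogeneous: "x \<in> grade i \<Longrightarrow> part j x = (if j = i then x else 0)"
  by (rule part_eqI) (cases i; cases j; auto simp: grade_closed)+

lemma part_linear: "clinear (part i :: 'a \<Rightarrow> 'a::super_space)"
proof (rule clinearI)
  fix x y :: 'a and c
  have "(x + y) - (part i x + part i y) = (x - part i x) + (y - part i y)" by simp
  then show "part i (x + y) = part i x + part i y"
    by (metis part_eqI part_props grade_closed(1))
  have "c *\<^sub>C x - c *\<^sub>C part i x = c *\<^sub>C (x - part i x)"
    by (simp add: cv.scale_right_diff_distrib)
  then show "part i (c *\<^sub>C x) = c *\<^sub>C part i x"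
    by (metis part_eqI part_props grade_closed(3))
qed

lemma parity_aut_homogeneous: "x \<in> grade i \<Longrightarrow> parity_aut x = sign i *\<^sub>C x"
  by (cases i) (simp_all add: parity_aut_def part_homogeneous)

lemma parity_aut_linear: "clinear parity_aut"
  by (rule clinearI) (simp_all add: parity_aut_def clinear_simps[OF part_linear]
      algebra_simps cv.scale_right_distrib)

lemma homogeneous_induct [case_names homogeneous add]:
  assumes "\<And>i x. x \<in> grade i \<Longrightarrow> P x" "\<And>x y. P x \<Longrightarrow> P y \<Longrightarrow> P (x + y)"
  shows "P (x :: 'a::super_space)"
  using assms(2)[of "part 0 x" "part 1 x"] assms(1)[OF part_props(1)] by (simp add: part_sum)

instantiation prod :: (super_space, super_space) super_space
begin
definition grade_prod :: "bit \<Rightarrow> ('a \<times> 'b) set" where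
  "grade_prod i = grade i \<times> grade i"
instance
proof
  fix i and x :: "'a \<times> 'b"
  show "0 \<in> (grade i :: ('a \<times> 'b) set)"
    by (simp add: grade_prod_def zero_prod_def zero_grade)
  show "x + y \<in> grade i" if "x \<in> grade i" "y \<in> grade i" for y
    using that by (auto simp: grade_prod_def add_grade)
  show "c *\<^sub>C x \<in> grade i" if "x \<in> grade i" for c
    using that by (auto simp: grade_prod_def scaleC_prod_def scaleC_grade)
  show "\<exists>y z. y \<in> grade 0 \<and> z \<in> grade 1 \<and> x = y + z"
    by (rule exI[of _ "(part 0 (fst x), part 0 (snd x))"],
        rule exI[of _ "(part 1 (fst x), part 1 (snd x))"])
       (simp add: grade_prod_def part_props part_sum)
  show "grade 0 \<inter> grade 1 = {0 :: 'a \<times> 'b}"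
    using grade_disjoint[where 'a = 'a] grade_disjoint[where 'a = 'b]
    by (auto simp: grade_prod_def zero_prod_def)
qed
end


section \<open>Associative algebras and superalgebras\<close>

class calgebra = ring + monoid_mult + cvector_space +
  assumes mult_scaleC_left: "(c *\<^sub>C x) * y = c *\<^sub>C (x * y)"
    and mult_scaleC_right: "x * (c *\<^sub>C y) = c *\<^sub>C (x * y)"

class superalgebra = calgebra + super_space +
  assumes one_grade: "1 \<in> grade 0"
    and mult_grade: "x \<in> grade i \<Longrightarrow> y \<in> grade j \<Longrightarrow> x * y \<in> grade (i + j)"

instance complex :: calgebra
  by standard (simp_all add: scaleC_complex_def)

lemmas mult_scaleC = mult_scaleC_left mult_scaleC_right


section \<open>Tensor products\<close>

lemma equivp_span: "equivp (\<lambda>p q. p - q \<in> cv.span S)"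
proof (rule equivpI)
  show "reflp (\<lambda>p q. p - q \<in> cv.span S)"
    by (rule reflpI) (simp add: cv.span_zero)
  show "symp (\<lambda>p q. p - q \<in> cv.span S)"
    by (rule sympI) (drule cv.span_neg, simp)
  show "transp (\<lambda>p q. p - q \<in> cv.span S)"
    by (rule transpI) (drule (1) cv.span_add, simp)
qed

lemma span_diff_cong:
  assumes "p - p' \<in> cv.span S" "q - q' \<in> cv.span S"
  shows "(p + q) - (p' + q') \<in> cv.span S" "(p - q) - (p' - q') \<in> cv.span S"
    "- p - - p' \<in> cv.span S" "c *\<^sub>C p - c *\<^sub>C p' \<in> cv.span S"
  using cv.span_add[OF assms] cv.span_diff[OF assms] cv.span_neg[OF assms(1)]
    cv.span_scale[OF assms(1), of c]
  by (simp_all add: algebra_simps cv.scale_right_diff_distrib)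

text \<open>The free vector space on pairs modulo the bilinearity relations.\<close>

definition tensor_relations :: "('a::cvector_space \<times> 'b::cvector_space \<Rightarrow>\<^sub>0 complex) set" where
  "tensor_relations =
     {basis_vec (x + x', y) - basis_vec (x, y) - basis_vec (x', y) | x x' y. True} \<union>
     {basis_vec (x, y + y') - basis_vec (x, y) - basis_vec (x, y') | x y y'. True} \<union>
     {basis_vec (c *\<^sub>C x, y) - c *\<^sub>C basis_vec (x, y) | c x y. True} \<union>
     {basis_vec (x, c *\<^sub>C y) - c *\<^sub>C basis_vec (x, y) | c x y. True}"

quotient_type (overloaded) ('a, 'b) tensor =
  "'a::cvector_space \<times> 'b::cvector_space \<Rightarrow>\<^sub>0 complex"
  / "\<lambda>p q. p - q \<in> cv.span tensor_relations"
  by (rule equivp_span)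

instantiation tensor :: (cvector_space, cvector_space) cvector_space
begin

lift_definition zero_tensor :: "('a, 'b) tensor" is 0 .

lift_definition plus_tensor :: "('a, 'b) tensor \<Rightarrow> ('a, 'b) tensor \<Rightarrow> ('a, 'b) tensor" is "(+)"
  by (rule span_diff_cong)

lift_definition uminus_tensor :: "('a, 'b) tensor \<Rightarrow> ('a, 'b) tensor" is uminus
  by (rule span_diff_cong)

lift_definition minus_tensor :: "('a, 'b) tensor \<Rightarrow> ('a, 'b) tensor \<Rightarrow> ('a, 'b) tensor" is "(-)"
  by (rule span_diff_cong)

lift_definition scaleC_tensor :: "complex \<Rightarrow> ('a, 'b) tensor \<Rightarrow> ('a, 'b) tensor" is scaleC
  by (rule span_diff_cong)

instance
  by standard (transfer, simp add: algebra_simps scaleC_right_distrib scaleC_left_distrib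
      scaleC_scaleC scaleC_one cv.span_zero)+

end

lift_definition tensor_of :: "'a::cvector_space \<Rightarrow> 'b::cvector_space \<Rightarrow> ('a, 'b) tensor"
  (infixr "\<otimes>" 73) is "\<lambda>x y. basis_vec (x, y)" .

lemma abs_tensor_linear: "clinear abs_tensor"
  by (rule clinearI) (simp_all add: plus_tensor.abs_eq scaleC_tensor.abs_eq)

lemma tensor_of_bilinear:
  "(x + x') \<otimes> y = x \<otimes> y + x' \<otimes> y" "x \<otimes> (y + y') = x \<otimes> y + x \<otimes> y'"
  "(c *\<^sub>C x) \<otimes> y = c *\<^sub>C (x \<otimes> y)" "x \<otimes> (c *\<^sub>C y) = c *\<^sub>C (x \<otimes> y)"
proof -
  note lin = clinear_simps[OF abs_tensor_linear]
  have add: "abs_tensor p = abs_tensor q + abs_tensor r" if "p - q - r \<in> tensor_relations" for p q r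
    using that unfolding lin(1)[symmetric] tensor.abs_eq_iff
    by (intro cv.span_base) (simp add: diff_diff_eq)
  have scale: "abs_tensor p = c *\<^sub>C abs_tensor q" if "p - c *\<^sub>C q \<in> tensor_relations" for p c q
    using that unfolding lin(2)[symmetric] tensor.abs_eq_iff by (rule cv.span_base)
  show "(x + x') \<otimes> y = x \<otimes> y + x' \<otimes> y" "x \<otimes> (y + y') = x \<otimes> y + x \<otimes> y'"
    unfolding tensor_of.abs_eq by (rule add; unfold tensor_relations_def; blast)+
  show "(c *\<^sub>C x) \<otimes> y = c *\<^sub>C (x \<otimes> y)" "x \<otimes> (c *\<^sub>C y) = c *\<^sub>C (x \<otimes> y)"
    unfolding tensor_of.abs_eq by (rule scale; unfold tensor_relations_def; blast)+
qed

lemma abs_tensor_cases [case_names abs]: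
  obtains p where "t = abs_tensor p"
  by (metis Quotient3_abs_rep[OF Quotient3_tensor])

lemma tensor_of_linear: "clinear (\<lambda>x. x \<otimes> y)" "clinear (\<lambda>y. x \<otimes> y)"
  by (rule clinearI; simp add: tensor_of_bilinear)+

lemma tensor_induct [case_names pure add]:
  fixes t :: "('a::cvector_space, 'b::cvector_space) tensor"
  assumes "\<And>x y. P (x \<otimes> y)" "\<And>s t. P s \<Longrightarrow> P t \<Longrightarrow> P (s + t)"
  shows "P t"
proof -
  have "P (abs_tensor p)" for p
  proof (induction p rule: free_induct)
    case zero
    have "(0 :: 'a) \<otimes> (0 :: 'b) = abs_tensor 0"
      using tensor_of_bilinear(3)[of 0 "0 :: 'a" "0 :: 'b"] by (simp add: zero_tensor.abs_eq[symmetric])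
    then show ?case using assms(1)[of 0 0] by simp
  next
    case (single k c)
    have "abs_tensor (Poly_Mapping.single k c) = (c *\<^sub>C fst k) \<otimes> snd k"
      unfolding tensor_of_bilinear(3)
      by (simp add: tensor_of.abs_eq scaleC_tensor.abs_eq scaleC_single)
    then show ?case using assms(1) by simp
  next
    case (add p q)
    then show ?case using assms(2) by (simp add: plus_tensor.abs_eq[symmetric])
  qed
  then show ?thesis by (cases t rule: abs_tensor_cases) auto
qed

definition bilinear_map :: "('a::cvector_space \<Rightarrow> 'b::cvector_space \<Rightarrow> 'c::cvector_space) \<Rightarrow> bool" where
  "bilinear_map b \<longleftrightarrow> (\<forall>y. clinear (\<lambda>x. b x y)) \<and> (\<forall>x. clinear (b x))"

text \<open>The linear map induced by a bilinear map; meaningful only for bilinear \<open>b\<close>.\<close>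

definition tensor_lift ::
  "('a::cvector_space \<Rightarrow> 'b::cvector_space \<Rightarrow> 'c::cvector_space) \<Rightarrow> ('a, 'b) tensor \<Rightarrow> 'c" where
  "tensor_lift b t = free_extend (\<lambda>(x, y). b x y) (rep_tensor t)"

lemma bilinear_mapD:
  assumes "bilinear_map b"
  shows "clinear (\<lambda>x. b x y)" "clinear (b x)"
  using assms by (auto simp: bilinear_map_def)

lemma tensor_lift_abs:
  assumes "bilinear_map b"
  shows "tensor_lift b (abs_tensor p) = free_extend (\<lambda>(x, y). b x y) p"
proof -
  let ?f = "free_extend (\<lambda>(x, y). b x y)"
  note lin = free_extend_linear[of "\<lambda>(x, y). b x y"]
  have "rep_tensor (abs_tensor p) - p \<in> cv.span tensor_relations"
    using Quotient3_abs_rep[OF Quotient3_tensor] tensor.abs_eq_iff by metis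
  moreover have "?f r = 0" if "r \<in> tensor_relations" for r
    using that unfolding tensor_relations_def
    by (auto simp: clinear_simps[OF lin] free_extend_single scaleC_one
        clinear_simps[OF bilinear_mapD(1)[OF assms]] clinear_simps[OF bilinear_mapD(2)[OF assms]])
  ultimately have "?f (rep_tensor (abs_tensor p) - p) = 0"
    by (rule clinear_vanish_span[OF lin, rotated])
  then show ?thesis by (simp add: tensor_lift_def clinear_simps[OF lin])
qed

lemma tensor_lift_pure: "bilinear_map b \<Longrightarrow> tensor_lift b (x \<otimes> y) = b x y"
  by (simp add: tensor_of.abs_eq tensor_lift_abs free_extend_single scaleC_one)

lemma tensor_lift_linear:
  assumes "bilinear_map b"
  shows "clinear (tensor_lift b)"
proof (rule clinearI)
  fix s t :: "('a, 'b) tensor" and c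
  note lin = free_extend_linear[of "\<lambda>(x, y). b x y"]
  show "tensor_lift b (s + t) = tensor_lift b s + tensor_lift b t"
    by (cases s rule: abs_tensor_cases; cases t rule: abs_tensor_cases) (simp add: plus_tensor.abs_eq tensor_lift_abs[OF assms] clinear_simps[OF lin])
  show "tensor_lift b (c *\<^sub>C s) = c *\<^sub>C tensor_lift b s"
    by (cases s rule: abs_tensor_cases) (simp add: scaleC_tensor.abs_eq tensor_lift_abs[OF assms] clinear_simps[OF lin])
qed

subsection \<open>The superalgebra structure on a tensor product\<close>

text \<open>\<open>(u\<^sub>1 \<otimes> u\<^sub>2) (v\<^sub>1 \<otimes> v\<^sub>2) = (-1)\<^bsup>p(u\<^sub>2) p(v\<^sub>1)\<^esup> (u\<^sub>1 v\<^sub>1) \<otimes> (u\<^sub>2 v\<^sub>2)\<close> on homogeneous elements.\<close>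

definition pure_mult ::
  "'a::superalgebra \<Rightarrow> 'b::superalgebra \<Rightarrow> 'a \<Rightarrow> 'b \<Rightarrow> ('a, 'b) tensor" where
  "pure_mult u\<^sub>1 u\<^sub>2 v\<^sub>1 v\<^sub>2 =
     (\<Sum>i\<in>{0,1}. \<Sum>j\<in>{0,1}. sign (i * j) *\<^sub>C ((u\<^sub>1 * part j v\<^sub>1) \<otimes> (part i u\<^sub>2 * v\<^sub>2)))"

lemma pure_mult_linear:
  "clinear (\<lambda>u\<^sub>1. pure_mult u\<^sub>1 u\<^sub>2 v\<^sub>1 v\<^sub>2)" "clinear (\<lambda>u\<^sub>2. pure_mult u\<^sub>1 u\<^sub>2 v\<^sub>1 v\<^sub>2)"
  "clinear (\<lambda>v\<^sub>1. pure_mult u\<^sub>1 u\<^sub>2 v\<^sub>1 v\<^sub>2)" "clinear (\<lambda>v\<^sub>2. pure_mult u\<^sub>1 u\<^sub>2 v\<^sub>1 v\<^sub>2)"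
  by (rule clinearI; simp add: pure_mult_def clinear_simps[OF part_linear] tensor_of_bilinear
      distrib_left distrib_right mult_scaleC cv.scale_right_distrib
      cv.scale_right_diff_distrib algebra_simps)+

lemma pure_mult_bilinear_right: "bilinear_map (pure_mult u\<^sub>1 u\<^sub>2)"
  by (auto simp: bilinear_map_def pure_mult_linear)

lemma pure_mult_bilinear_left: "bilinear_map (\<lambda>u\<^sub>1 u\<^sub>2. tensor_lift (pure_mult u\<^sub>1 u\<^sub>2) t)"
proof -
  note lin = clinear_simps[OF tensor_lift_linear[OF pure_mult_bilinear_right]]
  note pure = tensor_lift_pure[OF pure_mult_bilinear_right]
  have 1: "tensor_lift (pure_mult (x + x') y) t =
      tensor_lift (pure_mult x y) t + tensor_lift (pure_mult x' y) t" for x x' y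
    by (induction t rule: tensor_induct)
       (simp only: pure, simp add: clinear_simps[OF pure_mult_linear(1)], simp add: lin)
  have 2: "tensor_lift (pure_mult x (y + y')) t =
      tensor_lift (pure_mult x y) t + tensor_lift (pure_mult x y') t" for x y y'
    by (induction t rule: tensor_induct)
       (simp only: pure, simp add: clinear_simps[OF pure_mult_linear(2)], simp add: lin)
  have 3: "tensor_lift (pure_mult (c *\<^sub>C x) y) t = c *\<^sub>C tensor_lift (pure_mult x y) t" for c x y
    by (induction t rule: tensor_induct)
       (simp only: pure, simp add: clinear_simps[OF pure_mult_linear(1)],
        simp add: lin cv.scale_right_distrib)
  have 4: "tensor_lift (pure_mult x (c *\<^sub>C y)) t = c *\<^sub>C tensor_lift (pure_mult x y) t" for c x y
    by (induction t rule: tensor_induct)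
       (simp only: pure, simp add: clinear_simps[OF pure_mult_linear(2)],
        simp add: lin cv.scale_right_distrib)
  show ?thesis
    unfolding bilinear_map_def by (intro conjI allI clinearI 1 2 3 4)
qed

lemma tensor_homogeneous_induct [case_names pure add]:
  fixes t :: "('a::super_space, 'b::super_space) tensor"
  assumes "\<And>x y i j. x \<in> grade i \<Longrightarrow> y \<in> grade j \<Longrightarrow> P (x \<otimes> y)"
    and "\<And>s t. P s \<Longrightarrow> P t \<Longrightarrow> P (s + t)"
  shows "P t"
proof (induction t rule: tensor_induct)
  case (pure x y)
  have "x \<otimes> y = (part 0 x \<otimes> part 0 y + part 0 x \<otimes> part 1 y) + (part 1 x \<otimes> part 0 y + part 1 x \<otimes> part 1 y)"
    by (simp only: tensor_of_bilinear(1,2)[symmetric] part_sum)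
  also have "P \<dots>" by (intro assms(2)) (rule assms(1)[OF part_props(1) part_props(1)])+
  finally show ?case .
qed (rule assms(2))

instantiation tensor :: (superalgebra, superalgebra) calgebra
begin

definition one_tensor :: "('a, 'b) tensor" where
  "one_tensor = 1 \<otimes> 1"

definition times_tensor :: "('a, 'b) tensor \<Rightarrow> ('a, 'b) tensor \<Rightarrow> ('a, 'b) tensor" where
  "times_tensor s t = tensor_lift (\<lambda>u\<^sub>1 u\<^sub>2. tensor_lift (pure_mult u\<^sub>1 u\<^sub>2) t) s"

lemma times_tensor_linear:
  "clinear (\<lambda>s :: ('a, 'b) tensor. s * t)" "clinear (\<lambda>t :: ('a, 'b) tensor. s * t)"
proof -
  note left = tensor_lift_linear[OF pure_mult_bilinear_left]
  note right = tensor_lift_linear[OF pure_mult_bilinear_right]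
  show "clinear (\<lambda>s :: ('a, 'b) tensor. s * t)"
    unfolding times_tensor_def by (rule left)
  show "clinear (\<lambda>t :: ('a, 'b) tensor. s * t)"
  proof (induction s rule: tensor_induct)
    case (pure x y)
    have "(\<lambda>t. (x \<otimes> y) * t) = tensor_lift (pure_mult x y)"
      unfolding times_tensor_def tensor_lift_pure[OF pure_mult_bilinear_left] ..
    then show ?case using right by metis
  next
    case (add s s')
    have eq: "(s + s') * t = s * t + s' * t" for t
      unfolding times_tensor_def by (simp add: clinear_simps[OF left])
    show ?case unfolding eq
      by (rule clinearI) (simp_all add: clinear_simps[OF add(1)] clinear_simps[OF add(2)]
          cv.scale_right_distrib ac_simps)
  qed
qed

lemma times_tensor_homogeneous:
  assumes "u\<^sub>2 \<in> grade i" "v\<^sub>1 \<in> grade j"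
  shows "((u\<^sub>1 :: 'a) \<otimes> (u\<^sub>2 :: 'b)) * (v\<^sub>1 \<otimes> v\<^sub>2) = sign (i * j) *\<^sub>C ((u\<^sub>1 * v\<^sub>1) \<otimes> (u\<^sub>2 * v\<^sub>2))"
proof -
  have "(u\<^sub>1 \<otimes> u\<^sub>2) * (v\<^sub>1 \<otimes> v\<^sub>2) = pure_mult u\<^sub>1 u\<^sub>2 v\<^sub>1 v\<^sub>2"
    unfolding times_tensor_def tensor_lift_pure[OF pure_mult_bilinear_left]
    by (rule tensor_lift_pure[OF pure_mult_bilinear_right])
  then show ?thesis
    by (cases i; cases j) (simp_all add: pure_mult_def part_homogeneous[OF assms(1)]
        part_homogeneous[OF assms(2)] clinear_simps[OF tensor_of_linear(1)]
        clinear_simps[OF tensor_of_linear(2)] scaleC_one)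
qed

instance
proof
  fix a b c :: "('a, 'b) tensor" and k
  note lin = clinear_simps[OF times_tensor_linear(1)] clinear_simps[OF times_tensor_linear(2)]
  show "(a + b) * c = a * c + b * c" "a * (b + c) = a * b + a * c"
    "k *\<^sub>C a * b = k *\<^sub>C (a * b)" "a * k *\<^sub>C b = k *\<^sub>C (a * b)"
    by (simp_all add: lin)
  show "1 * a = a"
    by (induction a rule: tensor_homogeneous_induct)
       (simp_all add: lin one_tensor_def times_tensor_homogeneous[OF one_grade] scaleC_one)
  show "a * 1 = a"
    by (induction a rule: tensor_homogeneous_induct)
       (simp_all add: lin one_tensor_def times_tensor_homogeneous[OF _ one_grade] scaleC_one)
  show "a * b * c = a * (b * c)"
  proof (induction a rule: tensor_homogeneous_induct)
    case (pure a\<^sub>1 a\<^sub>2 i\<^sub>1 i\<^sub>2)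
    note a = pure
    show ?case
    proof (induction b rule: tensor_homogeneous_induct)
      case (pure b\<^sub>1 b\<^sub>2 j\<^sub>1 j\<^sub>2)
      note b = pure
      show ?case
      proof (induction c rule: tensor_homogeneous_induct)
        case (pure c\<^sub>1 c\<^sub>2 k\<^sub>1 k\<^sub>2)
        have "sign (i\<^sub>2 * j\<^sub>1) * sign ((i\<^sub>2 + j\<^sub>2) * k\<^sub>1) = sign (j\<^sub>2 * k\<^sub>1) * sign (i\<^sub>2 * (j\<^sub>1 + k\<^sub>1))"
          by (simp add: distrib_left distrib_right sign_add)
        then show ?case
          using a b pure
          by (simp add: lin times_tensor_homogeneous[OF a(2) b(1)]
              times_tensor_homogeneous[OF b(2) pure(1)]
              times_tensor_homogeneous[OF mult_grade[OF a(2) b(2)] pure(1)]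
              times_tensor_homogeneous[OF a(2) mult_grade[OF b(1) pure(1)]] mult.assoc)
      qed (simp add: lin)
    qed (simp add: lin)
  qed (simp add: lin)
qed

end


section \<open>Lie superalgebras\<close>

class lie_superalgebra = super_space +
  fixes bracket :: "'a \<Rightarrow> 'a \<Rightarrow> 'a"
  assumes bracket_add_left: "bracket (x + y) z = bracket x z + bracket y z"
    and bracket_add_right: "bracket x (y + z) = bracket x y + bracket x z"
    and bracket_scaleC_left: "bracket (c *\<^sub>C x) y = c *\<^sub>C bracket x y"
    and bracket_scaleC_right: "bracket x (c *\<^sub>C y) = c *\<^sub>C bracket x y"
    and bracket_grade: "x \<in> grade i \<Longrightarrow> y \<in> grade j \<Longrightarrow> bracket x y \<in> grade (i + j)"
    and bracket_skew: "x \<in> grade i \<Longrightarrow> y \<in> grade j \<Longrightarrow>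
      bracket x y = - (sign (i * j) *\<^sub>C bracket y x)"
    and bracket_jacobi: "x \<in> grade i \<Longrightarrow> y \<in> grade j \<Longrightarrow>
      bracket x (bracket y z) = bracket (bracket x y) z + sign (i * j) *\<^sub>C bracket y (bracket x z)"

lemma bracket_linear: "clinear (\<lambda>x. bracket x y)" "clinear (bracket x)"
  by (rule clinearI; simp add: bracket_add_left bracket_add_right bracket_scaleC_left
      bracket_scaleC_right)+

instantiation prod :: (lie_superalgebra, lie_superalgebra) lie_superalgebra
begin
definition bracket_prod :: "'a \<times> 'b \<Rightarrow> 'a \<times> 'b \<Rightarrow> 'a \<times> 'b" where
  "bracket_prod x y = (bracket (fst x) (fst y), bracket (snd x) (snd y))"
instance
proof
  fix x y z :: "'a \<times> 'b" and c i j
  show "bracket (x + y) z = bracket x z + bracket y z"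
    "bracket x (y + z) = bracket x y + bracket x z"
    "bracket (c *\<^sub>C x) y = c *\<^sub>C bracket x y"
    "bracket x (c *\<^sub>C y) = c *\<^sub>C bracket x y"
    by (simp_all add: bracket_prod_def scaleC_prod_def bracket_add_left bracket_add_right
        bracket_scaleC_left bracket_scaleC_right)
  assume "x \<in> grade i" "y \<in> grade j"
  then have *: "fst x \<in> grade i" "snd x \<in> grade i" "fst y \<in> grade j" "snd y \<in> grade j"
    by (auto simp: grade_prod_def)
  show "bracket x y \<in> grade (i + j)"
    unfolding bracket_prod_def grade_prod_def by (intro SigmaI bracket_grade *)
  show "bracket x y = - (sign (i * j) *\<^sub>C bracket y x)"
    using bracket_skew[OF *(1) *(3)] bracket_skew[OF *(2) *(4)]
    by (simp add: bracket_prod_def scaleC_prod_def)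
  show "bracket x (bracket y z) = bracket (bracket x y) z + sign (i * j) *\<^sub>C bracket y (bracket x z)"
    using bracket_jacobi[OF *(1) *(3)] bracket_jacobi[OF *(2) *(4)]
    by (simp add: bracket_prod_def scaleC_prod_def)
qed
end


section \<open>The universal enveloping algebra\<close>

subsection \<open>The free associative algebra on a set\<close>

datatype 'a free_monoid = Free_Monoid (letters: "'a list")

instantiation free_monoid :: (type) monoid_add
begin
definition zero_free_monoid :: "'a free_monoid" where
  "zero_free_monoid = Free_Monoid []"
definition plus_free_monoid :: "'a free_monoid \<Rightarrow> 'a free_monoid \<Rightarrow> 'a free_monoid" where
  "plus_free_monoid v w = Free_Monoid (letters v @ letters w)"
instance by standard (simp_all add: zero_free_monoid_def plus_free_monoid_def)
end

lemma letters_zero: "letters 0 = []"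
  by (simp add: zero_free_monoid_def)

text \<open>The monoid algebra of the free monoid, with the convolution product.\<close>

type_synonym 'a free_algebra = "'a free_monoid \<Rightarrow>\<^sub>0 complex"

abbreviation gen :: "'a \<Rightarrow> 'a free_algebra" where
  "gen x \<equiv> basis_vec (Free_Monoid [x])"

lemma free_algebra_mult_scaleC:
  fixes p q :: "'a free_algebra"
  shows "(c *\<^sub>C p) * q = c *\<^sub>C (p * q)" "p * (c *\<^sub>C q) = c *\<^sub>C (p * q)"
proof -
  have scale: "c *\<^sub>C r = Poly_Mapping.single 0 c * r" for r :: "'a free_algebra"
    by (simp add: scaleC_poly_mapping_def scaleC_complex_def mult_map_scale_conv_mult)
  have comm: "p * Poly_Mapping.single 0 c = Poly_Mapping.single 0 c * p"
    by (induction p rule: free_induct) (simp_all add: mult_single algebra_simps)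
  show "(c *\<^sub>C p) * q = c *\<^sub>C (p * q)" by (simp add: scale mult.assoc)
  show "p * (c *\<^sub>C q) = c *\<^sub>C (p * q)" by (simp add: scale comm flip: mult.assoc)
qed

definition free_algebra_extend :: "('a \<Rightarrow> 'b::calgebra) \<Rightarrow> 'a free_algebra \<Rightarrow> 'b" where
  "free_algebra_extend f = free_extend (\<lambda>w. prod_list (map f (letters w)))"

lemma free_algebra_extend_linear: "clinear (free_algebra_extend f)"
  by (simp add: free_algebra_extend_def free_extend_linear)

lemma free_algebra_extend_single:
  "free_algebra_extend f (Poly_Mapping.single w c) = c *\<^sub>C prod_list (map f (letters w))"
  by (simp add: free_algebra_extend_def free_extend_single)

lemma free_algebra_extend_gen: "free_algebra_extend f (gen x) = f x"
  by (simp add: free_algebra_extend_single scaleC_one)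

lemma free_algebra_extend_one: "free_algebra_extend f 1 = 1"
  using free_algebra_extend_single[of f 0 1] by (simp add: letters_zero scaleC_one)

lemma free_algebra_extend_mult:
  "free_algebra_extend f (p * q) = free_algebra_extend f p * free_algebra_extend f q"
proof (induction p rule: free_induct)
  case (single v c)
  show ?case
  proof (induction q rule: free_induct)
    case (single w d)
    show ?case
      by (simp add: mult_single free_algebra_extend_single plus_free_monoid_def mult_scaleC ac_simps)
  qed (simp_all add: clinear_simps[OF free_algebra_extend_linear] distrib_left)
qed (simp_all add: clinear_simps[OF free_algebra_extend_linear] distrib_right)

subsection \<open>Construction\<close>

text \<open>
  The first two families of relations turn the free algebra on the set \<open>\<gg>\<close> into the tensor algebra
  of the vector space \<open>\<gg>\<close>; the third imposes \<open>xy - (-1)\<^bsup>p(x) p(y)\<^esup> yx = [x, y]\<close>.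
\<close>

definition uea_relations :: "'a::lie_superalgebra free_algebra set" where
  "uea_relations =
     {gen (x + y) - gen x - gen y | x y. True} \<union>
     {gen (c *\<^sub>C x) - c *\<^sub>C gen x | c x. True} \<union>
     {gen x * gen y - sign (i * j) *\<^sub>C (gen y * gen x) - gen (bracket x y) | x y i j.
        x \<in> grade i \<and> y \<in> grade j}"

definition uea_ideal :: "'a::lie_superalgebra free_algebra set" where
  "uea_ideal = cv.span {a * r * b | a r b. r \<in> uea_relations}"

quotient_type (overloaded) 'a uea = "'a::lie_superalgebra free_algebra"
  / "\<lambda>p q. p - q \<in> uea_ideal"
  unfolding uea_ideal_def by (rule equivp_span)

lemma uea_ideal_mult:
  assumes "p \<in> uea_ideal"
  shows "p * q \<in> uea_ideal" "q * p \<in> uea_ideal"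
proof -
  show "p * q \<in> uea_ideal"
    using assms unfolding uea_ideal_def
  proof (induction p rule: cv.span_induct_alt)
    case base
    then show ?case by (simp add: cv.span_zero)
  next
    case (step c x y)
    obtain a r b where "r \<in> uea_relations" "x * q = a * r * (b * q)"
      using step(1) by (auto simp: mult.assoc)
    then have "x * q \<in> {a * r * b | a r b. r \<in> uea_relations}" by blast
    then show ?case using step(2)
      by (simp add: distrib_right free_algebra_mult_scaleC cv.span_add cv.span_scale cv.span_base)
  qed
  show "q * p \<in> uea_ideal"
    using assms unfolding uea_ideal_def
  proof (induction p rule: cv.span_induct_alt)
    case base
    then show ?case by (simp add: cv.span_zero)
  next
    case (step c x y)
    obtain a r b where "r \<in> uea_relations" "q * x = (q * a) * r * b"
      using step(1) by (auto simp: mult.assoc)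
    then have "q * x \<in> {a * r * b | a r b. r \<in> uea_relations}" by blast
    then show ?case using step(2)
      by (simp add: distrib_left free_algebra_mult_scaleC cv.span_add cv.span_scale cv.span_base)
  qed
qed

lemma uea_relation_ideal: "r \<in> uea_relations \<Longrightarrow> r \<in> uea_ideal"
  unfolding uea_ideal_def by (rule cv.span_base) (force intro: exI[of _ 1])

lemmas uea_ideal_diff_cong = span_diff_cong[of _ _ "{a * r * b | a r b. r \<in> uea_relations}",
    folded uea_ideal_def]

instantiation uea :: (lie_superalgebra) calgebra
begin

lift_definition zero_uea :: "'a uea" is 0 .

lift_definition one_uea :: "'a uea" is 1 .

lift_definition plus_uea :: "'a uea \<Rightarrow> 'a uea \<Rightarrow> 'a uea" is "(+)"
  by (rule uea_ideal_diff_cong)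

lift_definition uminus_uea :: "'a uea \<Rightarrow> 'a uea" is uminus
  by (rule uea_ideal_diff_cong)

lift_definition minus_uea :: "'a uea \<Rightarrow> 'a uea \<Rightarrow> 'a uea" is "(-)"
  by (rule uea_ideal_diff_cong)

lift_definition scaleC_uea :: "complex \<Rightarrow> 'a uea \<Rightarrow> 'a uea" is scaleC
  by (rule uea_ideal_diff_cong)

lift_definition times_uea :: "'a uea \<Rightarrow> 'a uea \<Rightarrow> 'a uea" is "(*)"
proof -
  fix p p' q q' :: "'a free_algebra"
  assume "p - p' \<in> uea_ideal" "q - q' \<in> uea_ideal"
  then have "(p - p') * q \<in> uea_ideal" "p' * (q - q') \<in> uea_ideal" by (auto intro: uea_ideal_mult)
  then have "(p - p') * q + p' * (q - q') \<in> uea_ideal"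
    unfolding uea_ideal_def by (rule cv.span_add)
  then show "p * q - p' * q' \<in> uea_ideal" by (simp add: algebra_simps)
qed

instance
  by standard (transfer, simp add: algebra_simps scaleC_right_distrib scaleC_left_distrib
      scaleC_scaleC scaleC_one free_algebra_mult_scaleC uea_ideal_def cv.span_zero)+

end

lift_definition uea_of :: "'a::lie_superalgebra \<Rightarrow> 'a uea" is gen .

lemma abs_uea_linear: "clinear abs_uea"
  by (rule clinearI) (simp_all add: plus_uea.abs_eq scaleC_uea.abs_eq)

lemma uea_of_linear: "clinear uea_of"
proof (rule clinearI)
  fix x y :: 'a and c
  note lin = clinear_simps[OF abs_uea_linear]
  show "uea_of (x + y) = uea_of x + uea_of y"
    unfolding uea_of.abs_eq lin(1)[symmetric] uea.abs_eq_iff diff_diff_eq[symmetric]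
    by (rule uea_relation_ideal) (auto simp: uea_relations_def)
  show "uea_of (c *\<^sub>C x) = c *\<^sub>C uea_of x"
    unfolding uea_of.abs_eq lin(2)[symmetric] uea.abs_eq_iff
    by (rule uea_relation_ideal) (auto simp: uea_relations_def)
qed

lemma uea_of_bracket:
  assumes "x \<in> grade i" "y \<in> grade j"
  shows "uea_of (bracket x y) = uea_of x * uea_of y - sign (i * j) *\<^sub>C (uea_of y * uea_of x)"
proof -
  note lin = clinear_simps[OF abs_uea_linear]
  have "gen x * gen y - sign (i * j) *\<^sub>C (gen y * gen x) - gen (bracket x y) \<in> uea_ideal"
    using assms by (intro uea_relation_ideal) (unfold uea_relations_def, blast)
  then show ?thesis
    unfolding uea_of.abs_eq times_uea.abs_eq lin(2)[symmetric] lin(4)[symmetric]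
    by (subst eq_commute) (simp only: uea.abs_eq_iff)
qed

lemma abs_uea_cases [case_names abs]:
  obtains p where "u = abs_uea p"
  by (metis Quotient3_abs_rep[OF Quotient3_uea])

lemma uea_induct [case_names one mult scale add]:
  assumes "P 1" "\<And>x u. P u \<Longrightarrow> P (uea_of x * u)" "\<And>c u. P u \<Longrightarrow> P (c *\<^sub>C u)"
    "\<And>u v. P u \<Longrightarrow> P v \<Longrightarrow> P (u + v)"
  shows "P (u :: 'a::lie_superalgebra uea)"
proof -
  have word: "P (abs_uea (basis_vec (Free_Monoid xs)))" for xs :: "'a list"
  proof (induction xs)
    case Nil
    then show ?case using assms(1) single_one[where 'a = "'a free_monoid" and 'b = complex]
      by (simp add: one_uea.abs_eq zero_free_monoid_def)
  next
    case (Cons x xs)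
    have "basis_vec (Free_Monoid (x # xs)) = gen x * basis_vec (Free_Monoid xs)"
      by (simp add: mult_single plus_free_monoid_def)
    then show ?case using assms(2)[OF Cons]
      by (simp add: uea_of.abs_eq times_uea.abs_eq)
  qed
  have "P (abs_uea p)" for p
  proof (induction p rule: free_induct)
    case zero
    then show ?case using assms(3)[OF assms(1), of 0] by (simp add: zero_uea.abs_eq)
  next
    case (single k c)
    then show ?case using assms(3)[OF word, of c "letters k"]
      by (simp add: scaleC_uea.abs_eq scaleC_single)
  next
    case (add p q)
    then show ?case using assms(4) by (simp add: plus_uea.abs_eq[symmetric])
  qed
  then show ?thesis by (cases u rule: abs_uea_cases) auto
qed

subsection \<open>Universal property\<close>

definition lie_map :: "('a::lie_superalgebra \<Rightarrow> 'b::calgebra) \<Rightarrow> bool" where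
  "lie_map f \<longleftrightarrow> clinear f \<and>
     (\<forall>i j. \<forall>x\<in>grade i. \<forall>y\<in>grade j. f (bracket x y) = f x * f y - sign (i * j) *\<^sub>C (f y * f x))"

text \<open>The algebra homomorphism induced by \<open>f\<close>; meaningful only if \<open>lie_map f\<close>.\<close>

definition uea_lift :: "('a::lie_superalgebra \<Rightarrow> 'b::calgebra) \<Rightarrow> 'a uea \<Rightarrow> 'b" where
  "uea_lift f u = free_algebra_extend f (rep_uea u)"

lemma uea_lift_abs:
  assumes "lie_map f"
  shows "uea_lift f (abs_uea p) = free_algebra_extend f p"
proof -
  note lin = clinear_simps[OF free_algebra_extend_linear]
  have f: "clinear f" using assms by (simp add: lie_map_def)
  have "rep_uea (abs_uea p) - p \<in> uea_ideal"
    using Quotient3_abs_rep[OF Quotient3_uea] uea.abs_eq_iff by metis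
  moreover have "free_algebra_extend f r = 0" if "r \<in> uea_relations" for r
    using that assms unfolding uea_relations_def lie_map_def
    by (auto simp: lin free_algebra_extend_gen free_algebra_extend_mult clinear_simps[OF f])
  then have "free_algebra_extend f r = 0" if "r \<in> {a * r * b | a r b. r \<in> uea_relations}" for r
    using that by (auto simp: free_algebra_extend_mult)
  ultimately have "free_algebra_extend f (rep_uea (abs_uea p) - p) = 0"
    unfolding uea_ideal_def by (rule clinear_vanish_span[OF free_algebra_extend_linear, rotated])
  then show ?thesis by (simp add: uea_lift_def lin)
qed

lemma uea_lift_hom:
  assumes "lie_map f"
  shows "clinear (uea_lift f)" "uea_lift f 1 = 1" "uea_lift f (u * v) = uea_lift f u * uea_lift f v"
    "uea_lift f (uea_of x) = f x"
proof -
  note lin = clinear_simps[OF free_algebra_extend_linear]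
  note abs = uea_lift_abs[OF assms]
  show "clinear (uea_lift f)"
  proof (rule clinearI)
    fix u v c
    show "uea_lift f (u + v) = uea_lift f u + uea_lift f v"
      by (cases u rule: abs_uea_cases; cases v rule: abs_uea_cases)
         (simp add: plus_uea.abs_eq abs lin)
    show "uea_lift f (c *\<^sub>C u) = c *\<^sub>C uea_lift f u"
      by (cases u rule: abs_uea_cases) (simp add: scaleC_uea.abs_eq abs lin)
  qed
  show "uea_lift f 1 = 1" by (simp add: one_uea.abs_eq abs free_algebra_extend_one)
  show "uea_lift f (u * v) = uea_lift f u * uea_lift f v"
    by (cases u rule: abs_uea_cases; cases v rule: abs_uea_cases)
       (simp add: times_uea.abs_eq abs free_algebra_extend_mult)
  show "uea_lift f (uea_of x) = f x" by (simp add: uea_of.abs_eq abs free_algebra_extend_gen)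
qed

subsection \<open>Grading\<close>

inductive homogeneous_monomial :: "bit \<Rightarrow> 'a::lie_superalgebra uea \<Rightarrow> bool" where
  one: "homogeneous_monomial 0 1"
| mult: "x \<in> grade i \<Longrightarrow> homogeneous_monomial j u \<Longrightarrow> homogeneous_monomial (i + j) (uea_of x * u)"

lemma lie_map_parity_aut: "lie_map (\<lambda>x. uea_of (parity_aut x))"
  unfolding lie_map_def
proof (intro conjI allI ballI)
  show "clinear (\<lambda>x. uea_of (parity_aut x))"
    by (rule clinear_compose[OF parity_aut_linear uea_of_linear])
  fix i j and x y :: 'a assume xy: "x \<in> grade i" "y \<in> grade j"
  show "uea_of (parity_aut (bracket x y)) = uea_of (parity_aut x) * uea_of (parity_aut y) -
      sign (i * j) *\<^sub>C (uea_of (parity_aut y) * uea_of (parity_aut x))"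
    by (simp add: parity_aut_homogeneous[OF xy(1)] parity_aut_homogeneous[OF xy(2)]
        parity_aut_homogeneous[OF bracket_grade[OF xy]] clinear_simps[OF uea_of_linear]
        uea_of_bracket[OF xy] mult_scaleC sign_add cv.scale_right_diff_distrib ac_simps)
qed

instantiation uea :: (lie_superalgebra) super_space
begin

definition grade_uea :: "bit \<Rightarrow> 'a uea set" where
  "grade_uea i = cv.span {u. homogeneous_monomial i u}"

lemma uea_of_mult_grade:
  assumes "x \<in> grade i" "(u :: 'a uea) \<in> grade j"
  shows "uea_of x * u \<in> grade (i + j)"
  using assms(2) unfolding grade_uea_def
proof (induction u rule: cv.span_induct_alt)
  case base
  then show ?case by (simp add: cv.span_zero)
next
  case (step c u v)
  then have "uea_of x * u \<in> cv.span {u. homogeneous_monomial (i + j) u}"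
    using assms(1) by (intro cv.span_base) (simp add: homogeneous_monomial.mult)
  then show ?case using step by (simp add: distrib_left mult_scaleC cv.span_add cv.span_scale)
qed

lemma parity_eigenspace:
  assumes "(u :: 'a uea) \<in> grade i"
  shows "uea_lift (\<lambda>x. uea_of (parity_aut x)) u = sign i *\<^sub>C u"
proof -
  let ?s = "uea_lift (\<lambda>x. uea_of (parity_aut x))"
  note hom = uea_lift_hom[OF lie_map_parity_aut]
  have mono: "?s u = sign i *\<^sub>C u" if "homogeneous_monomial i u" for i and u :: "'a uea"
    using that
  proof (induction rule: homogeneous_monomial.induct)
    case one
    then show ?case by (simp add: hom scaleC_one)
  next
    case (mult x i j u)
    then show ?case
      by (simp add: hom parity_aut_homogeneous[OF mult(1)] clinear_simps[OF uea_of_linear]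
          mult_scaleC sign_add)
  qed
  have "clinear (\<lambda>u. ?s u - sign i *\<^sub>C u)"
    by (rule clinearI) (simp_all add: clinear_simps[OF hom(1)] algebra_simps
        cv.scale_right_distrib cv.scale_right_diff_distrib)
  from clinear_vanish_span[OF this, of "{u. homogeneous_monomial i u}" u] assms mono
  show ?thesis by (simp add: grade_uea_def)
qed

instance
proof
  fix i c and u v :: "'a uea"
  show "0 \<in> (grade i :: 'a uea set)" by (simp add: grade_uea_def cv.span_zero)
  have closed_add: "u + v \<in> grade i" if "u \<in> grade i" "v \<in> grade i" for i and u v :: "'a uea"
    using that by (simp add: grade_uea_def cv.span_add)
  have closed_scale: "c *\<^sub>C u \<in> grade i" if "u \<in> grade i" for i c and u :: "'a uea"
    using that by (simp add: grade_uea_def cv.span_scale)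
  show "u \<in> grade i \<Longrightarrow> v \<in> grade i \<Longrightarrow> u + v \<in> grade i" by (rule closed_add)
  show "u \<in> grade i \<Longrightarrow> c *\<^sub>C u \<in> grade i" by (rule closed_scale)
  show "\<exists>y z. y \<in> grade 0 \<and> z \<in> grade 1 \<and> u = y + z"
  proof (induction u rule: uea_induct)
    case one
    have "1 \<in> (grade 0 :: 'a uea set)" "0 \<in> (grade 1 :: 'a uea set)"
      unfolding grade_uea_def by (auto intro: cv.span_base cv.span_zero homogeneous_monomial.one)
    then show ?case by (metis add.right_neutral)
  next
    case (mult x u)
    then obtain y z where yz: "y \<in> grade 0" "z \<in> grade 1" "u = y + z" by blast
    let ?p = "uea_of (part 0 x)" and ?q = "uea_of (part 1 x)"
    have "uea_of x = ?p + ?q" by (simp add: part_sum flip: clinear_simps(1)[OF uea_of_linear])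
    then have "uea_of x * u = (?p * y + ?q * z) + (?p * z + ?q * y)"
      using yz(3) by (simp add: algebra_simps)
    moreover have "?p * y \<in> grade 0" "?q * z \<in> grade 0" "?p * z \<in> grade 1" "?q * y \<in> grade 1"
      using uea_of_mult_grade[OF part_props(1)[of 0 x] yz(1)]
        uea_of_mult_grade[OF part_props(1)[of 1 x] yz(2)]
        uea_of_mult_grade[OF part_props(1)[of 0 x] yz(2)]
        uea_of_mult_grade[OF part_props(1)[of 1 x] yz(1)] by simp_all
    ultimately show ?case using closed_add by blast
  next
    case (scale c u)
    then show ?case using closed_scale by (metis cv.scale_right_distrib)
  next
    case (add u v)
    then obtain y z y' z' where *: "y \<in> grade 0" "z \<in> grade 1" "u = y + z"
      "y' \<in> grade 0" "z' \<in> grade 1" "v = y' + z'" by blast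
    then have "y + y' \<in> grade 0" "z + z' \<in> grade 1" "u + v = (y + y') + (z + z')"
      by (simp_all add: closed_add)
    then show ?case by blast
  qed
  have "u = 0" if "u \<in> grade 0" "u \<in> grade 1" for u :: "'a uea"
  proof -
    have "u = - u" using parity_eigenspace[OF that(1)] parity_eigenspace[OF that(2)]
      by (simp add: scaleC_one)
    then have "u + u = 0" by (metis add.right_inverse)
    then have "2 *\<^sub>C u = 0" using scaleC_left_distrib[of 1 1 u] by simp
    then show ?thesis by simp
  qed
  moreover have "0 \<in> (grade i :: 'a uea set)" for i by (simp add: grade_uea_def cv.span_zero)
  ultimately show "grade 0 \<inter> grade 1 = {0 :: 'a uea}" by blast
qed

end

instance uea :: (lie_superalgebra) superalgebra
proof
  show "1 \<in> (grade 0 :: 'a uea set)"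
    unfolding grade_uea_def by (auto intro: cv.span_base homogeneous_monomial.one)
  fix i j and u v :: "'a uea"
  have mono: "homogeneous_monomial i u \<Longrightarrow> v \<in> grade j \<Longrightarrow> u * v \<in> grade (i + j)" for i u
    by (induction rule: homogeneous_monomial.induct)
       (auto simp: mult.assoc add.assoc uea_of_mult_grade)
  assume uv: "u \<in> grade i" "v \<in> grade j"
  from uv(1) show "u * v \<in> grade (i + j)"
    unfolding grade_uea_def[of i]
  proof (induction u rule: cv.span_induct_alt)
    case base
    then show ?case by (simp add: zero_grade)
  next
    case (step c x y)
    then show ?case using mono[OF _ uv(2)]
      by (simp add: distrib_right mult_scaleC add_grade scaleC_grade)
  qed
qed

lemma uea_of_grade:
  assumes "x \<in> grade i"
  shows "uea_of x \<in> grade i"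
  using uea_of_mult_grade[OF assms one_grade] by simp


section \<open>The dual of the enveloping algebra\<close>

subsection \<open>Coproduct and counit\<close>

definition coproduct :: "'a::lie_superalgebra uea \<Rightarrow> ('a uea, 'a uea) tensor" where
  "coproduct = uea_lift (\<lambda>x. uea_of x \<otimes> 1 + 1 \<otimes> uea_of x)"

definition counit :: "'a::lie_superalgebra uea \<Rightarrow> complex" where
  "counit = uea_lift (\<lambda>x. 0)"

lemma lie_map_coproduct: "lie_map (\<lambda>x. uea_of x \<otimes> 1 + 1 \<otimes> uea_of x)"
  unfolding lie_map_def
proof (intro conjI allI ballI)
  show "clinear (\<lambda>x :: 'a. uea_of x \<otimes> (1 :: 'a uea) + (1 :: 'a uea) \<otimes> uea_of x)"
    by (rule clinearI) (simp_all add: clinear_simps[OF uea_of_linear] tensor_of_bilinear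
        cv.scale_right_distrib ac_simps)
  fix i j and x y :: 'a assume xy: "x \<in> grade i" "y \<in> grade j"
  note g = uea_of_grade[OF xy(1)] uea_of_grade[OF xy(2)]
  have 1: "(1 :: 'a uea) \<in> grade 0" by (rule one_grade)
  let ?X = "uea_of x" and ?Y = "uea_of y"
  have sq: "sign (i * j) * sign (i * j) = 1" by (cases i; cases j) simp_all
  have c: "j * i = i * j" by (rule mult.commute)
  show "uea_of (bracket x y) \<otimes> 1 + 1 \<otimes> uea_of (bracket x y) =
      (?X \<otimes> 1 + 1 \<otimes> ?X) * (?Y \<otimes> 1 + 1 \<otimes> ?Y) -
      sign (i * j) *\<^sub>C ((?Y \<otimes> 1 + 1 \<otimes> ?Y) * (?X \<otimes> 1 + 1 \<otimes> ?X))"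
    by (simp add: uea_of_bracket[OF xy] distrib_left distrib_right
        times_tensor_homogeneous[OF 1 g(2)] times_tensor_homogeneous[OF 1 g(1)]
        times_tensor_homogeneous[OF 1 1] times_tensor_homogeneous[OF g(1) 1]
        times_tensor_homogeneous[OF g(2) 1] times_tensor_homogeneous[OF g(1) g(2)]
        times_tensor_homogeneous[OF g(2) g(1)] scaleC_one cv.scale_right_distrib sq c
        clinear_simps[OF tensor_of_linear(1)] clinear_simps[OF tensor_of_linear(2)])
qed

lemma coproduct_hom:
  "clinear coproduct" "coproduct 1 = 1" "coproduct (u * v) = coproduct u * coproduct v"
  "coproduct (uea_of x) = uea_of x \<otimes> 1 + 1 \<otimes> uea_of x"
  unfolding coproduct_def by (rule uea_lift_hom[OF lie_map_coproduct])+

lemma lie_map_zero: "lie_map (\<lambda>x. 0 :: 'b::calgebra)"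
  by (auto simp: lie_map_def intro: clinearI)

lemma counit_hom:
  "clinear counit" "counit 1 = 1" "counit (u * v) = counit u * counit v" "counit (uea_of x) = 0"
  unfolding counit_def by (rule uea_lift_hom[OF lie_map_zero])+

subsection \<open>Product of functionals\<close>

text \<open>
  The component of parity \<open>j\<close> of \<open>l\<close>: a functional is homogeneous of parity \<open>j\<close> if it
  vanishes on the elements of the other parity.
\<close>

definition functional_part :: "bit \<Rightarrow> ('a::super_space \<Rightarrow> complex) \<Rightarrow> 'a \<Rightarrow> complex" where
  "functional_part j l = (\<lambda>u. l (part j u))"

text \<open>\<open>(l\<^sub>1 \<otimes> l\<^sub>2) (u\<^sub>1 \<otimes> u\<^sub>2) = (-1)\<^bsup>p(u\<^sub>1) p(l\<^sub>2)\<^esup> l\<^sub>1(u\<^sub>1) l\<^sub>2(u\<^sub>2)\<close> for homogeneous \<open>u\<^sub>1\<close> and \<open>l\<^sub>2\<close>.\<close>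

definition tensor_functional ::
  "('a::super_space \<Rightarrow> complex) \<Rightarrow> ('b::super_space \<Rightarrow> complex) \<Rightarrow> ('a, 'b) tensor \<Rightarrow> complex" where
  "tensor_functional l\<^sub>1 l\<^sub>2 = tensor_lift (\<lambda>u\<^sub>1 u\<^sub>2.
     \<Sum>i\<in>{0,1}. \<Sum>j\<in>{0,1}. sign (i * j) * l\<^sub>1 (part i u\<^sub>1) * functional_part j l\<^sub>2 u\<^sub>2)"

lemma tensor_functional_linear_pure:
  assumes "clinear l\<^sub>1" "clinear l\<^sub>2"
  shows "clinear (tensor_functional l\<^sub>1 l\<^sub>2)"
    and "tensor_functional l\<^sub>1 l\<^sub>2 (u\<^sub>1 \<otimes> u\<^sub>2) =
      (\<Sum>i\<in>{0,1}. \<Sum>j\<in>{0,1}. sign (i * j) * l\<^sub>1 (part i u\<^sub>1) * functional_part j l\<^sub>2 u\<^sub>2)"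
proof -
  have bil: "bilinear_map (\<lambda>u\<^sub>1 u\<^sub>2. \<Sum>i\<in>{0,1}. \<Sum>j\<in>{0,1}.
      sign (i * j) * l\<^sub>1 (part i u\<^sub>1) * functional_part j l\<^sub>2 u\<^sub>2)"
    unfolding bilinear_map_def
    by (intro conjI allI clinearI)
       (simp_all add: functional_part_def clinear_simps[OF part_linear] clinear_simps[OF assms(1)]
        clinear_simps[OF assms(2)] scaleC_complex_def algebra_simps)
  show "clinear (tensor_functional l\<^sub>1 l\<^sub>2)"
    unfolding tensor_functional_def by (rule tensor_lift_linear[OF bil])
  show "tensor_functional l\<^sub>1 l\<^sub>2 (u\<^sub>1 \<otimes> u\<^sub>2) =
      (\<Sum>i\<in>{0,1}. \<Sum>j\<in>{0,1}. sign (i * j) * l\<^sub>1 (part i u\<^sub>1) * functional_part j l\<^sub>2 u\<^sub>2)"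
    unfolding tensor_functional_def by (rule tensor_lift_pure[OF bil])
qed

lemma tensor_functional_homogeneous:
  assumes "clinear l\<^sub>1" "clinear l\<^sub>2" "u\<^sub>1 \<in> grade i" "\<And>u. u \<in> grade (j + 1) \<Longrightarrow> l\<^sub>2 u = 0"
  shows "tensor_functional l\<^sub>1 l\<^sub>2 (u\<^sub>1 \<otimes> u\<^sub>2) = sign (i * j) * l\<^sub>1 u\<^sub>1 * l\<^sub>2 u\<^sub>2"
proof -
  have "l\<^sub>2 (part (j + 1) u\<^sub>2) = 0" by (intro assms(4) part_props(1))
  moreover have "l\<^sub>2 u\<^sub>2 = l\<^sub>2 (part 0 u\<^sub>2) + l\<^sub>2 (part 1 u\<^sub>2)"
    by (simp add: part_sum flip: clinear_simps(1)[OF assms(2)])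
  ultimately show ?thesis
    by (cases i; cases j) (simp_all add: tensor_functional_linear_pure(2)[OF assms(1,2)]
        functional_part_def part_homogeneous[OF assms(3)] clinear_simps(3)[OF assms(1)])
qed

definition dual_mult ::
  "('a::lie_superalgebra uea \<Rightarrow> complex) \<Rightarrow> ('a uea \<Rightarrow> complex) \<Rightarrow> 'a uea \<Rightarrow> complex" where
  "dual_mult l\<^sub>1 l\<^sub>2 = (\<lambda>u. tensor_functional l\<^sub>1 l\<^sub>2 (coproduct u))"

text \<open>The counit is the unit element of the algebra \<open>U(\<gg>)\<^sup>*\<close>.\<close>

definition dual_subalgebra :: "('a::lie_superalgebra uea \<Rightarrow> complex) set \<Rightarrow> bool" where
  "dual_subalgebra A \<longleftrightarrow>
     (\<forall>l\<in>A. clinear l) \<and>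
     (\<lambda>u. 0) \<in> A \<and>
     (\<forall>l\<^sub>1\<in>A. \<forall>l\<^sub>2\<in>A. (\<lambda>u. l\<^sub>1 u + l\<^sub>2 u) \<in> A) \<and>
     (\<forall>c. \<forall>l\<in>A. (\<lambda>u. c * l u) \<in> A) \<and>
     counit \<in> A \<and>
     (\<forall>l\<^sub>1\<in>A. \<forall>l\<^sub>2\<in>A. dual_mult l\<^sub>1 l\<^sub>2 \<in> A)"

definition dual_algebra_iso ::
  "(('a::lie_superalgebra uea \<Rightarrow> complex) \<Rightarrow> ('b::lie_superalgebra uea \<Rightarrow> complex)) \<Rightarrow>
   ('a uea \<Rightarrow> complex) set \<Rightarrow> ('b uea \<Rightarrow> complex) set \<Rightarrow> bool" where
  "dual_algebra_iso \<Phi> A B \<longleftrightarrow>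
     bij_betw \<Phi> A B \<and>
     (\<forall>l\<^sub>1\<in>A. \<forall>l\<^sub>2\<in>A. \<Phi> (\<lambda>u. l\<^sub>1 u + l\<^sub>2 u) = (\<lambda>u. \<Phi> l\<^sub>1 u + \<Phi> l\<^sub>2 u)) \<and>
     (\<forall>c. \<forall>l\<in>A. \<Phi> (\<lambda>u. c * l u) = (\<lambda>u. c * \<Phi> l u)) \<and>
     \<Phi> counit = counit \<and>
     (\<forall>l\<^sub>1\<in>A. \<forall>l\<^sub>2\<in>A. \<Phi> (dual_mult l\<^sub>1 l\<^sub>2) = dual_mult (\<Phi> l\<^sub>1) (\<Phi> l\<^sub>2))"


section \<open>Invariant functionals\<close>

definition twisted_diagonal :: "('a::lie_superalgebra \<times> 'a) set" where
  "twisted_diagonal = {(x, parity_aut x) | x. True}"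

definition diagonal :: "('a::lie_superalgebra \<times> 'a) set" where
  "diagonal = {(x, x) | x. True}"

definition lie_subalgebra :: "'a::lie_superalgebra set \<Rightarrow> bool" where
  "lie_subalgebra H \<longleftrightarrow> cv.subspace H \<and> (\<forall>x\<in>H. \<forall>i. part i x \<in> H) \<and> (\<forall>x\<in>H. \<forall>y\<in>H. bracket x y \<in> H)"

lemma part_Pair: "part i (x, y) = (part i x, part i y)"
  by (rule part_eqI) (simp_all add: grade_prod_def part_props)

lemma parity_aut_bracket: "parity_aut (bracket x y) = bracket (parity_aut x) (parity_aut y)"
proof (induction x rule: homogeneous_induct)
  case (homogeneous i x)
  note x = homogeneous
  show ?case
  proof (induction y rule: homogeneous_induct)
    case (homogeneous j y)
    show ?case
      by (simp add: parity_aut_homogeneous[OF x] parity_aut_homogeneous[OF homogeneous]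
          parity_aut_homogeneous[OF bracket_grade[OF x homogeneous]] sign_add
          bracket_scaleC_left bracket_scaleC_right ac_simps)
  qed (simp add: bracket_add_right clinear_simps[OF parity_aut_linear])
qed (simp add: bracket_add_left clinear_simps[OF parity_aut_linear])

lemma lie_subalgebra_diagonals:
  "lie_subalgebra (twisted_diagonal :: ('a::lie_superalgebra \<times> 'a) set)"
  "lie_subalgebra (diagonal :: ('a::lie_superalgebra \<times> 'a) set)"
proof -
  have "part i (parity_aut x) = parity_aut (part i x)" for i and x :: 'a
    by (cases i) (simp_all add: parity_aut_homogeneous[OF part_props(1)] parity_aut_def
        clinear_simps[OF part_linear] part_homogeneous[OF part_props(1)] scaleC_one)
  then show "lie_subalgebra (twisted_diagonal :: ('a \<times> 'a) set)"
    by (auto simp: lie_subalgebra_def cv.subspace_def twisted_diagonal_def zero_prod_def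
        scaleC_prod_def part_Pair bracket_prod_def parity_aut_bracket
        clinear_simps[OF parity_aut_linear])
  show "lie_subalgebra (diagonal :: ('a \<times> 'a) set)"
    by (auto simp: lie_subalgebra_def cv.subspace_def diagonal_def zero_prod_def
        scaleC_prod_def part_Pair bracket_prod_def)
qed

definition biinvariant_functionals ::
  "'a::lie_superalgebra set \<Rightarrow> 'a set \<Rightarrow> ('a uea \<Rightarrow> complex) set" where
  "biinvariant_functionals H\<^sub>1 H\<^sub>2 = {l. clinear l \<and>
     (\<forall>x\<^sub>1\<in>H\<^sub>1. \<forall>u. l (uea_of x\<^sub>1 * u) = 0) \<and> (\<forall>x\<^sub>2\<in>H\<^sub>2. \<forall>u. l (u * uea_of x\<^sub>2) = 0)}"

text \<open>\<open>x * u = xu - (-1)\<^bsup>p(x) (p(u) + 1)\<^esup> ux\<close> for homogeneous \<open>x\<close> and \<open>u\<close>.\<close>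

definition star_action :: "'a::lie_superalgebra \<Rightarrow> 'a uea \<Rightarrow> 'a uea" where
  "star_action x u = (\<Sum>i\<in>{0,1}. \<Sum>j\<in>{0,1}.
     uea_of (part i x) * part j u - sign (i * (j + 1)) *\<^sub>C (part j u * uea_of (part i x)))"

definition star_invariant_functionals :: "('a::lie_superalgebra uea \<Rightarrow> complex) set" where
  "star_invariant_functionals = {l. clinear l \<and> (\<forall>x u. l (star_action x u) = 0)}"

lemma star_action_homogeneous:
  assumes "x \<in> grade i" "u \<in> grade j"
  shows "star_action x u = uea_of x * u - sign (i * (j + 1)) *\<^sub>C (u * uea_of x)"
  by (cases i; cases j) (simp_all add: star_action_def part_homogeneous[OF assms(1)]
      part_homogeneous[OF assms(2)] clinear_simps[OF uea_of_linear])

end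

theory Submission
  imports Defs
begin

text \<open>
  The isomorphism is restriction along the inclusion \<open>U(\<gg>) \<rightarrow> U(\<gg> \<oplus> \<gg>)\<close> of the first factor; it is
  multiplicative because this inclusion is a morphism of coalgebras. For the inverse, let
  \<open>U(\<gg> \<oplus> \<gg>)\<close> act on \<open>U(\<gg>)\<close> by \<open>(x, y) \<cdot> w = xw - (-1)\<^bsup>p(y) p(w)\<^esup> wy\<close>. The diagonal annihilates \<open>1\<close>,
  and \<open>(x, (-1)\<^bsup>p(x)\<^esup> x)\<close> acts by \<open>w \<mapsto> x * w\<close>, so \<open>l \<mapsto> (u \<mapsto> l (u \<cdot> 1))\<close> sends invariant functionals to
  biinvariant ones. Neither the Poincare-Birkhoff-Witt theorem nor a splitting
  \<open>U(\<gg> \<oplus> \<gg>) \<cong> U(\<gg>) \<otimes> U(\<gg>)\<close> is needed.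
\<close>

section \<open>The algebra of linear endomorphisms\<close>

text \<open>A type of its own, since the target of \<open>uea_lift\<close> has to be of class
  \<open>calgebra\<close>. With composition as product, a \<open>lie_map\<close> into it is a
  representation.\<close>

typedef (overloaded) 'a endo = "{f :: 'a::cvector_space \<Rightarrow> 'a. clinear f}"
  morphisms endo_apply Endo
  by (auto intro: clinearI exI[of _ "\<lambda>x. x"])

setup_lifting type_definition_endo

lemma clinear_zero: "clinear (\<lambda>x. 0)"
  by (rule clinearI) simp_all

lemma clinear_combinations:
  assumes "clinear f" "clinear g"
  shows "clinear (\<lambda>x. f x + g x)" "clinear (\<lambda>x. f x - g x)" "clinear (\<lambda>x. - f x)"
    "clinear (\<lambda>x. c *\<^sub>C f x)"
  by (rule clinearI; simp add: clinear_simps[OF assms(1)] clinear_simps[OF assms(2)]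
      cv.scale_right_distrib cv.scale_right_diff_distrib cv.scale_left_commute algebra_simps)+

lemma clinear_mult: "clinear l \<Longrightarrow> clinear (\<lambda>x. c * l x :: complex)"
  using clinear_combinations(4)[of l l c] by (simp add: scaleC_complex_def)

instantiation endo :: (cvector_space) calgebra
begin

lift_definition zero_endo :: "'a endo" is "\<lambda>x. 0" by (rule clinear_zero)
lift_definition one_endo :: "'a endo" is "\<lambda>x. x" by (rule clinearI) simp_all
lift_definition plus_endo :: "'a endo \<Rightarrow> 'a endo \<Rightarrow> 'a endo" is "\<lambda>f g x. f x + g x"
  by (rule clinear_combinations)
lift_definition minus_endo :: "'a endo \<Rightarrow> 'a endo \<Rightarrow> 'a endo" is "\<lambda>f g x. f x - g x"
  by (rule clinear_combinations)
lift_definition uminus_endo :: "'a endo \<Rightarrow> 'a endo" is "\<lambda>f x. - f x"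
  by (rule clinear_combinations)
lift_definition times_endo :: "'a endo \<Rightarrow> 'a endo \<Rightarrow> 'a endo" is "\<lambda>f g x. f (g x)"
  by (rule clinear_compose)
lift_definition scaleC_endo :: "complex \<Rightarrow> 'a endo \<Rightarrow> 'a endo" is "\<lambda>c f x. c *\<^sub>C f x"
  by (rule clinear_combinations)

instance
  by standard (transfer, auto simp: fun_eq_iff clinear_simps algebra_simps cv.scale_right_distrib
      cv.scale_left_distrib)+

end

lemmas endo_apply_simps = zero_endo.rep_eq one_endo.rep_eq plus_endo.rep_eq minus_endo.rep_eq
  uminus_endo.rep_eq times_endo.rep_eq scaleC_endo.rep_eq

lemma endo_apply_linear: "clinear (endo_apply f)"
  using endo_apply[of f] by simp


section \<open>Enveloping algebras\<close>

text \<open>A graded piece is spanned by homogeneous monomials. The predicate carries the parity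
  because each further letter shifts it.\<close>

lemma uea_grade_induct [consumes 1, case_names zero one mult add scale]:
  fixes u :: "'a::lie_superalgebra uea"
  assumes "u \<in> grade i"
    and zero: "\<And>i. P i 0"
    and one: "P 0 1"
    and mult: "\<And>i j x u. x \<in> grade i \<Longrightarrow> u \<in> grade j \<Longrightarrow> P j u \<Longrightarrow> P (i + j) (uea_of x * u)"
    and add: "\<And>i u v. P i u \<Longrightarrow> P i v \<Longrightarrow> P i (u + v)"
    and scale: "\<And>i c u. P i u \<Longrightarrow> P i (c *\<^sub>C u)"
  shows "P i u"
proof -
  have mono: "v \<in> grade k \<and> P k v" if "homogeneous_monomial k v" for k and v :: "'a uea"
    using that by induction (auto intro: one mult one_grade uea_of_mult_grade)
  show ?thesis
    using assms(1) unfolding grade_uea_def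
    by (induction u rule: cv.span_induct_alt) (auto intro: zero add scale dest: mono)
qed

lemma parity_aut_one: "parity_aut (1 :: 'a::superalgebra) = 1"
  using parity_aut_homogeneous[OF one_grade] by (simp add: scaleC_one)

subsection \<open>Functoriality\<close>

definition lie_hom :: "('a::lie_superalgebra \<Rightarrow> 'b::lie_superalgebra) \<Rightarrow> bool" where
  "lie_hom f \<longleftrightarrow> clinear f \<and> (\<forall>i. \<forall>x\<in>grade i. f x \<in> grade i) \<and>
     (\<forall>x y. f (bracket x y) = bracket (f x) (f y))"

definition uea_map :: "('a::lie_superalgebra \<Rightarrow> 'b::lie_superalgebra) \<Rightarrow> 'a uea \<Rightarrow> 'b uea" where
  "uea_map f = uea_lift (\<lambda>x. uea_of (f x))"

lemma lie_map_lie_hom: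
  assumes "lie_hom f"
  shows "lie_map (\<lambda>x. uea_of (f x))"
  using assms by (auto simp: lie_hom_def lie_map_def uea_of_bracket
      intro: clinear_compose uea_of_linear)

lemma uea_map_hom:
  assumes "lie_hom f"
  shows "clinear (uea_map f)" "uea_map f 1 = 1" "uea_map f (u * v) = uea_map f u * uea_map f v"
    "uea_map f (uea_of x) = uea_of (f x)"
  unfolding uea_map_def by (rule uea_lift_hom[OF lie_map_lie_hom[OF assms]])+

lemma uea_map_grade:
  assumes f: "lie_hom f" and u: "u \<in> grade i"
  shows "uea_map f u \<in> grade i"
  using u
proof (induction rule: uea_grade_induct)
  case (mult i j x u)
  then show ?case using f by (auto simp: uea_map_hom[OF f] lie_hom_def intro: uea_of_mult_grade)
qed (simp_all add: uea_map_hom[OF f] clinear_simps[OF uea_map_hom(1)[OF f]] zero_grade one_grade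
      add_grade scaleC_grade)

lemma counit_uea_map:
  assumes f: "lie_hom f"
  shows "counit (uea_map f u) = counit u"
  by (induction u rule: uea_induct)
     (simp_all add: uea_map_hom[OF f] clinear_simps[OF uea_map_hom(1)[OF f]] counit_hom
      clinear_simps[OF counit_hom(1)])

section \<open>Coproducts and products of functionals under induced maps\<close>

definition tensor_map :: "('a::cvector_space \<Rightarrow> 'c::cvector_space) \<Rightarrow>
    ('b::cvector_space \<Rightarrow> 'd::cvector_space) \<Rightarrow> ('a, 'b) tensor \<Rightarrow> ('c, 'd) tensor" where
  "tensor_map f g = tensor_lift (\<lambda>x y. f x \<otimes> g y)"

lemma tensor_map_linear_pure:
  assumes "clinear f" "clinear g"
  shows "clinear (tensor_map f g)" "tensor_map f g (x \<otimes> y) = f x \<otimes> g y"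
proof -
  have "bilinear_map (\<lambda>x y. f x \<otimes> g y)"
    unfolding bilinear_map_def
    by (intro conjI allI clinearI) (simp_all add: clinear_simps[OF assms(1)]
        clinear_simps[OF assms(2)] tensor_of_bilinear)
  then show "clinear (tensor_map f g)" "tensor_map f g (x \<otimes> y) = f x \<otimes> g y"
    unfolding tensor_map_def by (rule tensor_lift_linear, rule tensor_lift_pure)
qed

text \<open>The sign in a product of pure tensors depends only on the parities of the two inner
  factors, and \<open>uea_map f\<close> preserves parity.\<close>

lemma tensor_map_mult:
  assumes "lie_hom f"
  shows "tensor_map (uea_map f) (uea_map f) (s * t) =
    tensor_map (uea_map f) (uea_map f) s * tensor_map (uea_map f) (uea_map f) t"
proof -
  note hom = uea_map_hom[OF assms]
  note map_pure = tensor_map_linear_pure(2)[OF hom(1) hom(1)]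
  note lin = clinear_simps[OF tensor_map_linear_pure(1)[OF hom(1) hom(1)]]
  show ?thesis
  proof (induction s rule: tensor_homogeneous_induct)
    case (pure u\<^sub>1 u\<^sub>2 i\<^sub>1 i\<^sub>2)
    note u = this
    show ?case
    proof (induction t rule: tensor_homogeneous_induct)
      case (pure v\<^sub>1 v\<^sub>2 j\<^sub>1 j\<^sub>2)
      show ?case
        by (simp add: map_pure lin hom times_tensor_homogeneous[OF u(2) pure(1)]
            times_tensor_homogeneous[OF uea_map_grade[OF assms u(2)] uea_map_grade[OF assms pure(1)]])
    qed (simp add: distrib_left lin)
  qed (simp add: distrib_right lin)
qed

text \<open>Both sides are algebra homomorphisms in \<open>u\<close> that agree on
  generators.\<close>

lemma coproduct_uea_map:
  assumes "lie_hom f"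
  shows "coproduct (uea_map f u) = tensor_map (uea_map f) (uea_map f) (coproduct u)"
proof -
  note hom = uea_map_hom[OF assms]
  note map_pure = tensor_map_linear_pure(2)[OF hom(1) hom(1)]
  note lin = clinear_simps[OF tensor_map_linear_pure(1)[OF hom(1) hom(1)]]
  show ?thesis
    by (induction u rule: uea_induct)
       (simp_all add: hom clinear_simps[OF hom(1)] coproduct_hom clinear_simps[OF coproduct_hom(1)]
        lin map_pure tensor_map_mult[OF assms] one_tensor_def)
qed

text \<open>Here the parity is that of the second argument: on an element of parity \<open>j\<close>
  only the parity \<open>j\<close> component of the second functional is nonzero.\<close>

lemma tensor_functional_grade:
  assumes "clinear l\<^sub>1" "clinear l\<^sub>2" "u\<^sub>1 \<in> grade i" "u\<^sub>2 \<in> grade j"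
  shows "tensor_functional l\<^sub>1 l\<^sub>2 (u\<^sub>1 \<otimes> u\<^sub>2) = sign (i * j) * l\<^sub>1 u\<^sub>1 * l\<^sub>2 u\<^sub>2"
  by (cases i; cases j) (simp_all add: tensor_functional_linear_pure(2)[OF assms(1,2)]
      functional_part_def part_homogeneous[OF assms(3)] part_homogeneous[OF assms(4)]
      clinear_simps(3)[OF assms(1)] clinear_simps(3)[OF assms(2)])

lemma dual_mult_uea_map:
  assumes f: "lie_hom f" and l: "clinear l\<^sub>1" "clinear l\<^sub>2"
  shows "dual_mult l\<^sub>1 l\<^sub>2 (uea_map f u) =
    dual_mult (\<lambda>v. l\<^sub>1 (uea_map f v)) (\<lambda>v. l\<^sub>2 (uea_map f v)) u"
proof -
  note hom = uea_map_hom[OF f]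
  note map_pure = tensor_map_linear_pure(2)[OF hom(1) hom(1)]
  note lin = clinear_simps[OF tensor_map_linear_pure(1)[OF hom(1) hom(1)]]
  have l': "clinear (\<lambda>v. l\<^sub>1 (uea_map f v))" "clinear (\<lambda>v. l\<^sub>2 (uea_map f v))"
    using l hom(1) by (auto intro: clinear_compose)
  have "tensor_functional l\<^sub>1 l\<^sub>2 (tensor_map (uea_map f) (uea_map f) t) =
      tensor_functional (\<lambda>v. l\<^sub>1 (uea_map f v)) (\<lambda>v. l\<^sub>2 (uea_map f v)) t" for t
  proof (induction t rule: tensor_homogeneous_induct)
    case (pure x y i j)
    then show ?case
      by (simp add: map_pure tensor_functional_grade[OF l]
          tensor_functional_grade[OF l'] uea_map_grade[OF f])
  qed (simp add: lin clinear_simps[OF tensor_functional_linear_pure(1)[OF l]]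
        clinear_simps[OF tensor_functional_linear_pure(1)[OF l']])
  then show ?thesis by (simp add: dual_mult_def coproduct_uea_map[OF f])
qed

lemma dual_mult_linear: "clinear l\<^sub>1 \<Longrightarrow> clinear l\<^sub>2 \<Longrightarrow> clinear (dual_mult l\<^sub>1 l\<^sub>2)"
  unfolding dual_mult_def by (rule clinear_compose[OF coproduct_hom(1) tensor_functional_linear_pure(1)])


section \<open>Biinvariant functionals\<close>

text \<open>On a pure tensor each summand of the primitive element puts \<open>uea_of x\<close>, up
  to sign, on the outer side of one factor, where the corresponding functional vanishes.\<close>

lemma tensor_functional_vanish:
  assumes l: "clinear l\<^sub>1" "clinear l\<^sub>2" and x: "x \<in> grade k"
  shows "(\<And>u. l\<^sub>1 (uea_of x * u) = 0) \<Longrightarrow> (\<And>u. l\<^sub>2 (uea_of x * u) = 0) \<Longrightarrow>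
      tensor_functional l\<^sub>1 l\<^sub>2 ((uea_of x \<otimes> 1 + 1 \<otimes> uea_of x) * t) = 0"
    and "(\<And>u. l\<^sub>1 (u * uea_of x) = 0) \<Longrightarrow> (\<And>u. l\<^sub>2 (u * uea_of x) = 0) \<Longrightarrow>
      tensor_functional l\<^sub>1 l\<^sub>2 (t * (uea_of x \<otimes> 1 + 1 \<otimes> uea_of x)) = 0"
proof -
  note gx = uea_of_grade[OF x]
  note lin = clinear_simps[OF tensor_functional_linear_pure(1)[OF l]]
  note tf = tensor_functional_grade[OF l]
  show "tensor_functional l\<^sub>1 l\<^sub>2 ((uea_of x \<otimes> 1 + 1 \<otimes> uea_of x) * t) = 0"
    if "\<And>u. l\<^sub>1 (uea_of x * u) = 0" "\<And>u. l\<^sub>2 (uea_of x * u) = 0"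
  proof (induction t rule: tensor_homogeneous_induct)
    case (pure a b i j)
    show ?case
      by (simp add: distrib_right times_tensor_homogeneous[OF one_grade pure(1)]
          times_tensor_homogeneous[OF gx pure(1)] lin that
          tf[OF mult_grade[OF gx pure(1)] pure(2)] tf[OF pure(1) mult_grade[OF gx pure(2)]]
          cv.scale_zero_right)
  qed (simp add: distrib_left lin)
  show "tensor_functional l\<^sub>1 l\<^sub>2 (t * (uea_of x \<otimes> 1 + 1 \<otimes> uea_of x)) = 0"
    if "\<And>u. l\<^sub>1 (u * uea_of x) = 0" "\<And>u. l\<^sub>2 (u * uea_of x) = 0"
  proof (induction t rule: tensor_homogeneous_induct)
    case (pure a b i j)
    show ?case
      by (simp add: distrib_left times_tensor_homogeneous[OF pure(2) one_grade]
          times_tensor_homogeneous[OF pure(2) gx] lin that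
          tf[OF mult_grade[OF pure(1) gx] pure(2)] tf[OF pure(1) mult_grade[OF pure(2) gx]]
          cv.scale_zero_right)
  qed (simp add: distrib_right lin)
qed

lemma uea_of_parts: "uea_of x = uea_of (part 0 x) + uea_of (part 1 x)"
  by (simp add: part_sum flip: clinear_simps(1)[OF uea_of_linear])

lemma dual_subalgebra_biinvariant:
  assumes "lie_subalgebra H\<^sub>1" "lie_subalgebra H\<^sub>2"
  shows "dual_subalgebra (biinvariant_functionals H\<^sub>1 H\<^sub>2)"
  unfolding dual_subalgebra_def
proof (intro conjI ballI allI)
  fix l\<^sub>1 l\<^sub>2
  assume l: "l\<^sub>1 \<in> biinvariant_functionals H\<^sub>1 H\<^sub>2" "l\<^sub>2 \<in> biinvariant_functionals H\<^sub>1 H\<^sub>2"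
  then have lin: "clinear l\<^sub>1" "clinear l\<^sub>2" by (auto simp: biinvariant_functionals_def)
  note d = clinear_simps[OF dual_mult_linear[OF lin]]
  \<comment> \<open>Homogeneous components come first, so that the sign rule applies; they stay in
    the subalgebra because it is graded.\<close>
  have "dual_mult l\<^sub>1 l\<^sub>2 (uea_of (part i x) * u) = 0" if "x \<in> H\<^sub>1" for x i u
  proof -
    have "part i x \<in> H\<^sub>1" using that assms by (auto simp: lie_subalgebra_def)
    then show ?thesis using l unfolding dual_mult_def coproduct_hom
      by (intro tensor_functional_vanish(1)[OF lin part_props(1)])
         (auto simp: biinvariant_functionals_def)
  qed
  moreover have "dual_mult l\<^sub>1 l\<^sub>2 (u * uea_of (part i x)) = 0" if "x \<in> H\<^sub>2" for x i u
  proof -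
    have "part i x \<in> H\<^sub>2" using that assms by (auto simp: lie_subalgebra_def)
    then show ?thesis using l unfolding dual_mult_def coproduct_hom
      by (intro tensor_functional_vanish(2)[OF lin part_props(1)])
         (auto simp: biinvariant_functionals_def)
  qed
  ultimately have "dual_mult l\<^sub>1 l\<^sub>2 (uea_of x * u) = 0" if "x \<in> H\<^sub>1" for x u
    using that by (subst uea_of_parts) (simp add: distrib_right d)
  moreover have "dual_mult l\<^sub>1 l\<^sub>2 (u * uea_of x) = 0" if "x \<in> H\<^sub>2" for x u
    using that \<open>\<And>x u i. x \<in> H\<^sub>2 \<Longrightarrow> dual_mult l\<^sub>1 l\<^sub>2 (u * uea_of (part i x)) = 0\<close>
    by (subst uea_of_parts) (simp add: distrib_left d)
  ultimately show "dual_mult l\<^sub>1 l\<^sub>2 \<in> biinvariant_functionals H\<^sub>1 H\<^sub>2"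
    by (simp add: biinvariant_functionals_def dual_mult_linear[OF lin])
  show "(\<lambda>u. l\<^sub>1 u + l\<^sub>2 u) \<in> biinvariant_functionals H\<^sub>1 H\<^sub>2"
    using l by (auto simp: biinvariant_functionals_def intro: clinear_combinations)
next
  fix c l assume "l \<in> biinvariant_functionals H\<^sub>1 H\<^sub>2"
  then show "(\<lambda>u. c * l u) \<in> biinvariant_functionals H\<^sub>1 H\<^sub>2"
    by (auto simp: biinvariant_functionals_def intro: clinear_mult)
qed (auto simp: biinvariant_functionals_def counit_hom intro: clinear_zero)


section \<open>The action of \<open>U(\<gg> \<oplus> \<gg>)\<close> on \<open>U(\<gg>)\<close>\<close>

text \<open>
  The action in the header, with the sign \<open>(-1)\<^bsup>p(y) p(w)\<^esup>\<close> produced by \<^const>\<open>parity_aut\<close> on the odd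
  part of \<open>y\<close>. As a module this is \<open>U(\<gg> \<oplus> \<gg>)\<close> modulo the left ideal generated by the diagonal.
\<close>

definition two_sided :: "'a::lie_superalgebra \<times> 'a \<Rightarrow> 'a uea \<Rightarrow> 'a uea" where
  "two_sided z w = uea_of (fst z) * w -
     (w * uea_of (part 0 (snd z)) + parity_aut w * uea_of (part 1 (snd z)))"

lemma two_sided_linear: "clinear (\<lambda>z. two_sided z w)" "clinear (two_sided z)"
  by (rule clinearI; simp add: two_sided_def scaleC_prod_def clinear_simps[OF part_linear]
      clinear_simps[OF uea_of_linear] clinear_simps[OF parity_aut_linear] mult_scaleC
      cv.scale_right_distrib cv.scale_right_diff_distrib algebra_simps)+

lemma two_sided_homogeneous:
  assumes "z \<in> grade i" "w \<in> grade k"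
  shows "two_sided z w = uea_of (fst z) * w - sign (i * k) *\<^sub>C (w * uea_of (snd z))"
proof -
  have z: "snd z \<in> grade i" using assms(1) by (auto simp: grade_prod_def)
  show ?thesis
    by (cases i; cases k) (simp_all add: two_sided_def part_homogeneous[OF z]
        parity_aut_homogeneous[OF assms(2)] clinear_simps[OF uea_of_linear] scaleC_one mult_scaleC)
qed

lemma two_sided_grade:
  assumes "z \<in> grade i" "w \<in> grade k"
  shows "two_sided z w \<in> grade (i + k)"
proof -
  have z: "fst z \<in> grade i" "snd z \<in> grade i" using assms(1) by (auto simp: grade_prod_def)
  show ?thesis
    unfolding two_sided_homogeneous[OF assms]
    using mult_grade[OF assms(2) uea_of_grade[OF z(2)]]
    by (intro grade_closed uea_of_mult_grade z assms) (simp add: add.commute)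
qed

text \<open>Left multiplication and signed right multiplication supercommute, and each respects the
  bracket. On homogeneous \<open>w\<close> this is a comparison of signs for eight choices of
  parities.\<close>

lemma lie_map_two_sided: "lie_map (\<lambda>z. Endo (two_sided z))"
  unfolding lie_map_def
proof (intro conjI allI ballI)
  have app: "endo_apply (Endo (two_sided z)) = two_sided z" for z :: "'a \<times> 'a"
    by (simp add: Endo_inverse two_sided_linear)
  note ext = endo_apply_inject[THEN iffD1, OF HOL.ext]
  show "clinear (\<lambda>z :: 'a \<times> 'a. Endo (two_sided z))"
    by (rule clinearI; rule ext)
       (simp_all add: app endo_apply_simps clinear_simps[OF two_sided_linear(1)])
  fix i j and z z' :: "'a \<times> 'a" assume z: "z \<in> grade i" "z' \<in> grade j"
  then have c: "fst z \<in> grade i" "snd z \<in> grade i" "fst z' \<in> grade j" "snd z' \<in> grade j"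
    by (auto simp: grade_prod_def)
  have "two_sided (bracket z z') w = two_sided z (two_sided z' w) -
      sign (i * j) *\<^sub>C two_sided z' (two_sided z w)" for w
  proof (induction w rule: homogeneous_induct)
    case (homogeneous k w)
    note w = homogeneous
    note expand = two_sided_homogeneous[OF z(1) w] two_sided_homogeneous[OF z(2) w]
    note expand2 = two_sided_homogeneous[OF z(1) two_sided_grade[OF z(2) w], unfolded expand]
      two_sided_homogeneous[OF z(2) two_sided_grade[OF z(1) w], unfolded expand]
    have "two_sided (bracket z z') w = uea_of (bracket (fst z) (fst z')) * w -
        sign ((i + j) * k) *\<^sub>C (w * uea_of (bracket (snd z) (snd z')))"
      using two_sided_homogeneous[OF bracket_grade[OF z] w] by (simp add: bracket_prod_def)
    then show ?case
      unfolding expand expand2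
        uea_of_bracket[OF c(1,3)] uea_of_bracket[OF c(2,4)]
      by (cases i; cases j; cases k) (simp_all add: mult_scaleC scaleC_one algebra_simps)
  qed (simp add: clinear_simps[OF two_sided_linear(2)] cv.scale_right_distrib)
  then show "Endo (two_sided (bracket z z')) = Endo (two_sided z) * Endo (two_sided z') -
      sign (i * j) *\<^sub>C (Endo (two_sided z') * Endo (two_sided z))"
    by (intro ext) (simp add: app endo_apply_simps)
qed

text \<open>The orbit map of the vector \<open>1\<close> in this representation, hence a map of left
  modules.\<close>

definition collapse :: "('a::lie_superalgebra \<times> 'a) uea \<Rightarrow> 'a uea" where
  "collapse u = endo_apply (uea_lift (\<lambda>z. Endo (two_sided z)) u) 1"

lemma collapse_linear: "clinear collapse"
  by (rule clinearI) (simp_all add: collapse_def endo_apply_simps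
      clinear_simps[OF uea_lift_hom(1)[OF lie_map_two_sided]])

lemma collapse_one: "collapse 1 = 1"
  by (simp add: collapse_def uea_lift_hom[OF lie_map_two_sided] endo_apply_simps)

lemma collapse_mult_left: "collapse (uea_of z * u) = two_sided z (collapse u)"
  by (simp add: collapse_def uea_lift_hom[OF lie_map_two_sided] endo_apply_simps
      Endo_inverse two_sided_linear)

text \<open>The rightmost factor acts first, and on the even vector \<open>1\<close> the element
  \<open>(x, x)\<close> gives x - x.\<close>

lemma collapse_mult_diagonal: "collapse (u * uea_of (x, x)) = 0"
proof -
  have "two_sided (x, x) 1 = 0"
    by (simp add: two_sided_def parity_aut_one part_sum flip: clinear_simps(1)[OF uea_of_linear])
  then show ?thesis
    by (simp add: collapse_def uea_lift_hom[OF lie_map_two_sided] endo_apply_simps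
        Endo_inverse two_sided_linear clinear_simps[OF endo_apply_linear])
qed

text \<open>The factor (-1)^p(x) from \<open>parity_aut\<close> turns the sign (-1)^(p(x) p(u)) into
  (-1)^(p(x) (p(u) + 1)).\<close>

lemma star_action_eq_two_sided: "star_action x u = two_sided (x, parity_aut x) u"
proof (induction x rule: homogeneous_induct)
  case (homogeneous i x)
  note x = homogeneous
  then have z: "(x, parity_aut x) \<in> grade i"
    by (simp add: grade_prod_def parity_aut_homogeneous scaleC_grade)
  show ?case
  proof (induction u rule: homogeneous_induct)
    case (homogeneous j u)
    show ?case
      unfolding two_sided_homogeneous[OF z homogeneous] star_action_homogeneous[OF x homogeneous]
      by (simp add: parity_aut_homogeneous[OF x] clinear_simps[OF uea_of_linear] mult_scaleC distrib_left
          sign_add ac_simps)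
  next
    case (add u v)
    have "star_action x (u + v) = star_action x u + star_action x v"
      by (simp add: star_action_def clinear_simps[OF part_linear] cv.scale_right_distrib
          algebra_simps)
    with add show ?case by (simp add: clinear_simps[OF two_sided_linear(2)])
  qed
next
  case (add x y)
  have "star_action (x + y) u = star_action x u + star_action y u"
    by (simp add: star_action_def clinear_simps[OF part_linear] clinear_simps[OF uea_of_linear]
        cv.scale_right_distrib algebra_simps)
  with add show ?case
    using clinear_simps(1)[OF two_sided_linear(1), of "(x, parity_aut x)" "(y, parity_aut y)" u]
    by (simp add: clinear_simps[OF parity_aut_linear])
qed

subsection \<open>The first factor\<close>

abbreviation uea_fst :: "'a::lie_superalgebra uea \<Rightarrow> ('a \<times> 'a) uea" where
  "uea_fst \<equiv> uea_map (\<lambda>x. (x, 0))"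

lemma lie_hom_fst: "lie_hom (\<lambda>x :: 'a::lie_superalgebra. (x, 0 :: 'a))"
  by (auto simp: lie_hom_def grade_prod_def zero_grade bracket_prod_def scaleC_prod_def
      clinear_simps[OF bracket_linear(1)] intro: clinearI)

lemmas uea_fst_hom = uea_map_hom[OF lie_hom_fst]

text \<open>Since \<open>(x, 0)\<close> acts by plain left multiplication, a word in such letters
  acting on \<open>1\<close> rebuilds the original word. In particular \<open>uea_fst\<close> is
  injective.\<close>

lemma collapse_uea_fst: "collapse (uea_fst u) = u"
proof (induction u rule: uea_induct)
  case (mult x u)
  then show ?case
    by (simp add: uea_fst_hom collapse_mult_left two_sided_def clinear_simps[OF part_linear]
        clinear_simps[OF uea_of_linear])
qed (simp_all add: uea_fst_hom clinear_simps[OF uea_fst_hom(1)] collapse_one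
      clinear_simps[OF collapse_linear])

text \<open>The two summands have zero bracket, so \<open>(0, y)\<close> passes each letter with a
  sign, and these signs multiply to that of the whole word.\<close>

lemma uea_snd_commute:
  fixes u :: "'a::lie_superalgebra uea"
  assumes y: "y \<in> grade i" and u: "u \<in> grade k"
  shows "uea_of (0, y) * uea_fst u = sign (i * k) *\<^sub>C (uea_fst u * uea_of (0, y))"
  using u
proof (induction rule: uea_grade_induct)
  case (mult j k x u)
  have g: "(0 :: 'a, y) \<in> grade i" "(x, 0 :: 'a) \<in> grade j"
    using y mult by (auto simp: grade_prod_def zero_grade)
  have "bracket (0 :: 'a, y) (x, 0 :: 'a) = 0"
    by (simp add: bracket_prod_def clinear_simps[OF bracket_linear(1)]
        clinear_simps[OF bracket_linear(2)] zero_prod_def)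
  with uea_of_bracket[OF g]
  have "uea_of (0, y) * uea_of (x, 0) = sign (i * j) *\<^sub>C (uea_of (x, 0) * uea_of (0, y))"
    by (simp add: clinear_simps[OF uea_of_linear])
  then have "uea_of (0, y) * uea_fst (uea_of x * u) =
      sign (i * j) *\<^sub>C (uea_of (x, 0) * (uea_of (0, y) * uea_fst u))"
    by (simp add: uea_fst_hom mult_scaleC flip: mult.assoc)
  then show ?case
    by (simp add: mult.IH uea_fst_hom mult_scaleC distrib_left sign_add mult.assoc)
qed (simp_all add: uea_fst_hom clinear_simps[OF uea_fst_hom(1)] distrib_left distrib_right
      mult_scaleC cv.scale_right_distrib scaleC_one cv.scale_left_commute)

text \<open>Modulo the left ideal generated by the diagonal, \<open>(0, y)\<close> may be moved past
  the first factor and then replaced by \<open>(-y, 0)\<close>.\<close>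

lemma uea_fst_two_sided:
  fixes l :: "('a::lie_superalgebra \<times> 'a) uea \<Rightarrow> complex"
  assumes l: "clinear l" and inv: "\<And>x u. l (u * uea_of (x, x)) = 0"
  shows "l (uea_fst (two_sided z w)) = l (uea_of z * uea_fst w)"
proof -
  note lin = clinear_simps[OF l]
  have split: "uea_of (x, y) = uea_of (x, 0) + uea_of (0, y)" for x y :: 'a
    by (simp flip: clinear_simps(1)[OF uea_of_linear])
  have move: "l (u * uea_of (0, y)) = - l (u * uea_of (y, 0))" for u and y :: 'a
    using inv[of u y] by (subst (asm) split) (simp add: distrib_left lin eq_neg_iff_add_eq_0 add.commute)
  show ?thesis
  proof (induction z rule: homogeneous_induct)
    case (homogeneous i z)
    note z = homogeneous
    obtain x y where xy: "z = (x, y)" by (cases z)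
    then have y: "y \<in> grade i" using z by (auto simp: grade_prod_def)
    show ?case
    proof (induction w rule: homogeneous_induct)
      case (homogeneous k w)
      have "l (uea_of z * uea_fst w) =
          l (uea_of (x, 0) * uea_fst w) + sign (i * k) * l (uea_fst w * uea_of (0, y))"
        unfolding xy
        by (subst split) (simp add: distrib_right lin uea_snd_commute[OF y homogeneous] scaleC_complex_def)
      then show ?case
        unfolding two_sided_homogeneous[OF z homogeneous]
        by (simp add: clinear_simps[OF uea_fst_hom(1)]
            uea_fst_hom lin xy move scaleC_complex_def)
    qed (simp add: clinear_simps[OF two_sided_linear(2)] clinear_simps[OF uea_fst_hom(1)] lin distrib_left)
  qed (simp add: clinear_simps[OF two_sided_linear(1)] clinear_simps[OF uea_fst_hom(1)] lin
        clinear_simps[OF uea_of_linear] distrib_right)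
qed

text \<open>Such an \<open>l\<close> sees \<open>u\<close> only modulo the left ideal generated by
  the diagonal, and \<open>collapse\<close> selects a representative in the first factor.\<close>

lemma right_invariant_collapse:
  fixes l :: "('a::lie_superalgebra \<times> 'a) uea \<Rightarrow> complex"
  assumes "clinear l" "\<And>x u. l (u * uea_of (x, x)) = 0"
  shows "l (uea_fst (collapse u)) = l u"
  using assms
proof (induction u arbitrary: l rule: uea_induct)
  case (mult z u)
  \<comment> \<open>Prefixing \<open>uea_of z\<close> keeps the vanishing on the left ideal, so the
    induction, which runs over all \<open>l\<close> at once, applies to this functional.\<close>
  have "clinear (\<lambda>v. l (uea_of z * v))"
    by (rule clinearI) (simp_all add: clinear_simps[OF mult.prems(1)] distrib_left mult_scaleC)
  from mult.IH[OF this] mult.prems(2)[of "uea_of z * _"]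
  show ?case
    by (simp add: collapse_mult_left uea_fst_two_sided[OF mult.prems] mult.assoc)
next
  case (add u v)
  from add.IH[OF add.prems] add.prems(1) show ?case
    by (simp add: clinear_simps[OF collapse_linear] clinear_simps[OF uea_fst_hom(1)] clinear_simps)
qed (simp_all add: collapse_one uea_fst_hom clinear_simps[OF collapse_linear]
      clinear_simps[OF uea_fst_hom(1)] clinear_simps)

section \<open>The isomorphism by restriction to the first factor\<close>

theorem lemma1p4:
  fixes A :: "(('g::lie_superalgebra \<times> 'g) uea \<Rightarrow> complex) set"
    and B :: "('g uea \<Rightarrow> complex) set"
  assumes finite_dimensional: "\<exists>S :: 'g set. finite S \<and> cv.span S = UNIV"
    and A: "A = biinvariant_functionals twisted_diagonal diagonal"
    and B: "B = star_invariant_functionals"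
  shows "dual_subalgebra A \<and> dual_subalgebra B \<and> (\<exists>\<Phi>. dual_algebra_iso \<Phi> A B)"
proof -
  let ?\<Phi> = "\<lambda>(l :: ('g \<times> 'g) uea \<Rightarrow> complex) u. l (uea_fst u)"
  let ?\<Psi> = "\<lambda>(l :: 'g uea \<Rightarrow> complex) u. l (collapse u)"
  have A_iff: "l \<in> A \<longleftrightarrow> clinear l \<and> (\<forall>x u. l (uea_of (x, parity_aut x) * u) = 0) \<and>
      (\<forall>x u. l (u * uea_of (x, x)) = 0)" for l
    by (auto simp: A biinvariant_functionals_def twisted_diagonal_def diagonal_def)
  have B_iff: "l \<in> B \<longleftrightarrow> clinear l \<and> (\<forall>x u. l (two_sided (x, parity_aut x) u) = 0)" for l
    by (auto simp: B star_invariant_functionals_def star_action_eq_two_sided)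
  \<comment> \<open>Right invariance allows \<open>uea_fst_two_sided\<close>, which yields a left
    multiple by the twisted diagonal; left invariance then gives zero.\<close>
  have \<Phi>: "?\<Phi> l \<in> B" if "l \<in> A" for l
    using that uea_fst_two_sided[of l]
    by (auto simp: A_iff B_iff intro: clinear_compose[OF uea_fst_hom(1)])
  \<comment> \<open>Left invariance holds because \<open>collapse\<close> is a module map, right
    invariance because the diagonal annihilates \<open>1\<close>.\<close>
  have \<Psi>: "?\<Psi> l \<in> A" if "l \<in> B" for l
    using that by (auto simp: A_iff B_iff collapse_mult_left collapse_mult_diagonal clinear_simps
        intro: clinear_compose[OF collapse_linear])
  have inverse: "?\<Psi> (?\<Phi> l) = l" if "l \<in> A" for l
    using that by (auto simp: A_iff fun_eq_iff intro!: right_invariant_collapse)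
  have inverse': "?\<Phi> (?\<Psi> l) = l" for l
    by (simp add: collapse_uea_fst)
  have bij: "bij_betw ?\<Phi> A B"
    by (rule bij_betw_byWitness[where f' = ?\<Psi>]) (use \<Phi> \<Psi> inverse inverse' in auto)
  have subalgebra: "dual_subalgebra A"
    unfolding A by (intro dual_subalgebra_biinvariant lie_subalgebra_diagonals)
  have mult: "?\<Phi> (dual_mult l\<^sub>1 l\<^sub>2) = dual_mult (?\<Phi> l\<^sub>1) (?\<Phi> l\<^sub>2)" if "l\<^sub>1 \<in> A" "l\<^sub>2 \<in> A" for l\<^sub>1 l\<^sub>2
    using that by (auto simp: A_iff intro: dual_mult_uea_map[OF lie_hom_fst])
  have counit: "?\<Phi> counit = counit"
    by (simp add: counit_uea_map[OF lie_hom_fst])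
  have iso: "dual_algebra_iso ?\<Phi> A B"
    unfolding dual_algebra_iso_def using bij mult counit by auto
  \<comment> \<open>Closure is transported from \<open>A\<close>: the product is the restriction of
    the product of the two extensions.\<close>
  have "dual_mult l\<^sub>1 l\<^sub>2 \<in> B" if "l\<^sub>1 \<in> B" "l\<^sub>2 \<in> B" for l\<^sub>1 l\<^sub>2
    using \<Phi>[of "dual_mult (?\<Psi> l\<^sub>1) (?\<Psi> l\<^sub>2)"] mult[OF \<Psi> \<Psi>] that \<Psi> subalgebra
    by (simp add: inverse' dual_subalgebra_def)
  moreover have "counit \<in> B"
    using \<Phi>[of counit] subalgebra counit by (simp add: dual_subalgebra_def)
  moreover have "(\<lambda>u. c * l u) \<in> B" if "l \<in> B" for c l
    using that by (auto simp: B_iff intro: clinear_mult)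
  ultimately have "dual_subalgebra B"
    by (auto simp: dual_subalgebra_def B_iff intro: clinear_zero clinear_combinations)
  with subalgebra iso show ?thesis by blast
qed

end
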